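(* Let $\alpha=(\alpha_n)_{n\in\mathbb N}$ be a positive, strictly increasing sequence with $\alpha_n\to\infty$. The Cesàro operator $\mathsf C\in\mathcal L(E_\alpha)$ is power bounded and uniformly mean ergodic. In particular, $$E_\alpha=\ker(I-\mathsf C)\oplus\overline{(I-\mathsf C)(E_\alpha)}$$ with $$\ker(I-\mathsf C)=\mathrm{span}\{\mathbf 1\}\quad\text{and}\quad \overline{(I-\mathsf C)(E_\alpha)}=\{x\in E_\alpha: x_1=0\}=\overline{\mathrm{span}\{e_n\}_{n\ge2}}.$$
   Context: $\mathbb N=\{1,2,3,\dots\}$. For a strictly positive sequence $w$ on $\mathbb N$, $c_0(w)=\{x\in\mathbb C^{\mathbb N}: \lim_{n\to\infty} w(n)|x_n|=0\}$, a Banach space with norm $\sup_n w(n)|x_n|$. Given $\alpha$, fix a strictly increasing sequence $(s_k)_{k\in\mathbb N}\subset(1,\infty)$ with $s_k\to\infty$ and put $v_k(n):=s_k^{-\alpha_n}$. Define $E_\alpha:=\mathrm{ind}_k\, c_0(v_k)$, i.e. $E_\alpha=\bigcup_k c_0(v_k)\subseteq\mathbb C^{\mathbb N}$ endowed with the finest locally convex Hausdorff topology making all inclusions $c_0(v_k)\hookrightarrow E_\alpha$ continuous; $E_\alpha$ does not depend on the choice of $(s_k)$. The Cesàro operator is $\mathsf Cx=\left(\frac{x_1+\dots+x_n}{n}\right)_{n\in\mathbb N}$, and it belongs to $\mathcal L(E_\alpha)$ (continuous linear operators from $E_\alpha$ into itself). $\mathbf 1=(1)_{n\in\mathbb N}$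 is the constant sequence and $e_n=(\delta_{nk})_{k\in\mathbb N}$ are the canonical basis vectors; closures are in $E_\alpha$. For a locally convex Hausdorff space $X$, $T\in\mathcal L(X)$ is power bounded if $\{T^n\}_{n\ge1}$ is equicontinuous in $\mathcal L(X)$; $T$ is uniformly mean ergodic if the sequence $T_{[n]}=\frac1n\sum_{m=1}^nT^m$ converges in $\mathcal L_b(X)$, i.e. $\mathcal L(X)$ with the topology of uniform convergence on bounded subsets of $X$. *)

theory Defs
  imports "HOL-Analysis.Analysis" "HOL-Library.Function_Algebras"
begin

text \<open>
  Index convention: sequences indexed by \<open>{1, 2, 3, \<dots>}\<close> are functions on \<^typ>\<open>nat\<close>, the value at
  \<open>n\<close> being the entry with index \<open>n + 1\<close>. This applies to the elements of the sequence spaces, to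
  the weights, to \<open>\<alpha>\<close> and to \<open>s\<close>.
\<close>

type_synonym cseq = "nat \<Rightarrow> complex"

definition cscale :: "complex \<Rightarrow> cseq \<Rightarrow> cseq" where
  "cscale c x = (\<lambda>n. c * x n)"

interpretation cseq: vector_space cscale
  by unfold_locales (auto simp: cscale_def fun_eq_iff algebra_simps)


section \<open>Locally convex Hausdorff topologies on spaces of complex sequences\<close>

definition cseq_convex :: "cseq set \<Rightarrow> bool" where
  "cseq_convex V \<longleftrightarrow>
     (\<forall>x\<in>V. \<forall>y\<in>V. \<forall>t\<in>{0..1::real}. cscale (of_real (1 - t)) x + cscale (of_real t) y \<in> V)"

definition zero_nbhd :: "cseq topology \<Rightarrow> cseq set \<Rightarrow> bool" where
  "zero_nbhd X U \<longleftrightarrow> openin X U \<and> 0 \<in> U"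

definition lc_hausdorff :: "cseq topology \<Rightarrow> bool" where
  "lc_hausdorff X \<longleftrightarrow>
     cseq.subspace (topspace X) \<and>
     continuous_map (prod_topology X X) X (\<lambda>(x, y). x + y) \<and>
     continuous_map (prod_topology euclidean X) X (\<lambda>(c, x). cscale c x) \<and>
     (\<forall>U. zero_nbhd X U \<longrightarrow> (\<exists>V. zero_nbhd X V \<and> cseq_convex V \<and> V \<subseteq> U)) \<and>
     Hausdorff_space X"

definition bounded_in :: "cseq topology \<Rightarrow> cseq set \<Rightarrow> bool" where
  "bounded_in X B \<longleftrightarrow>
     B \<subseteq> topspace X \<and> (\<forall>U. zero_nbhd X U \<longrightarrow> (\<exists>r>0. B \<subseteq> cscale (of_real r) ` U))"


section \<open>Continuous linear operators\<close>

text \<open>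
  An operator on \<open>X\<close> is represented by a total function on sequences of which only the values on
  \<^term>\<open>topspace X\<close> matter. Accordingly, functions that agree on \<^term>\<open>topspace X\<close> are not
  distinguished by the topology of \<open>\<L>\<^sub>b(X)\<close> below.
\<close>

definition cont_ops :: "cseq topology \<Rightarrow> (cseq \<Rightarrow> cseq) set" where
  "cont_ops X = {T. continuous_map X X T \<and>
     (\<forall>x\<in>topspace X. \<forall>y\<in>topspace X. T (x + y) = T x + T y) \<and>
     (\<forall>c. \<forall>x\<in>topspace X. T (cscale c x) = cscale c (T x))}"

definition equicontinuous_ops :: "cseq topology \<Rightarrow> (cseq \<Rightarrow> cseq) set \<Rightarrow> bool" where
  "equicontinuous_ops X F \<longleftrightarrow>
     F \<subseteq> cont_ops X \<and>
     (\<forall>V. zero_nbhd X V \<longrightarrow> (\<exists>U. zero_nbhd X U \<and> (\<forall>T\<in>F. T ` U \<subseteq> V)))"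

definition power_bounded :: "cseq topology \<Rightarrow> (cseq \<Rightarrow> cseq) \<Rightarrow> bool" where
  "power_bounded X T \<longleftrightarrow> T \<in> cont_ops X \<and> equicontinuous_ops X {T ^^ n | n. 1 \<le> n}"

text \<open>The basic neighbourhoods of \<open>S\<close> in \<open>\<L>\<^sub>b(X)\<close> are the sets
  \<open>{R. (R - S) B \<subseteq> V}\<close> with \<open>B\<close> bounded and \<open>V\<close> a neighbourhood of zero.\<close>

definition Lb_open :: "cseq topology \<Rightarrow> (cseq \<Rightarrow> cseq) set \<Rightarrow> bool" where
  "Lb_open X W \<longleftrightarrow>
     W \<subseteq> cont_ops X \<and>
     (\<forall>S\<in>W. \<exists>B V. bounded_in X B \<and> zero_nbhd X V \<and>
        {R \<in> cont_ops X. \<forall>x\<in>B. R x - S x \<in> V} \<subseteq> W)"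

definition Lb_topology :: "cseq topology \<Rightarrow> (cseq \<Rightarrow> cseq) topology" where
  "Lb_topology X = topology (Lb_open X)"

definition ergodic_mean :: "(cseq \<Rightarrow> cseq) \<Rightarrow> nat \<Rightarrow> cseq \<Rightarrow> cseq" where
  "ergodic_mean T n = (\<lambda>x. cscale (1 / of_nat n) (\<Sum>m=1..n. (T ^^ m) x))"

definition uniformly_mean_ergodic :: "cseq topology \<Rightarrow> (cseq \<Rightarrow> cseq) \<Rightarrow> bool" where
  "uniformly_mean_ergodic X T \<longleftrightarrow>
     T \<in> cont_ops X \<and> (\<exists>P. limitin (Lb_topology X) (ergodic_mean T) P sequentially)"

text \<open>
  \<open>X = M \<oplus> N\<close> as a topological direct sum: bijectivity of the addition map is the algebraic part,
  continuity of its inverse is the continuity of the two projections.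
\<close>

definition direct_sum :: "cseq topology \<Rightarrow> cseq set \<Rightarrow> cseq set \<Rightarrow> bool" where
  "direct_sum X M N \<longleftrightarrow>
     M \<subseteq> topspace X \<and> N \<subseteq> topspace X \<and> cseq.subspace M \<and> cseq.subspace N \<and>
     homeomorphic_map (prod_topology (subtopology X M) (subtopology X N)) X (\<lambda>(x, y). x + y)"

lemma zero_nbhd_Int: "zero_nbhd X U \<Longrightarrow> zero_nbhd X V \<Longrightarrow> zero_nbhd X (U \<inter> V)"
  by (auto simp: zero_nbhd_def)

lemma bounded_in_Un:
  assumes X: "lc_hausdorff X" and A: "bounded_in X A" and B: "bounded_in X B"
  shows "bounded_in X (A \<union> B)"
  unfolding bounded_in_def
proof (intro conjI allI impI)
  show "A \<union> B \<subseteq> topspace X"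
    using A B by (auto simp: bounded_in_def)
next
  fix U assume U: "zero_nbhd X U"
  obtain V where V: "zero_nbhd X V" "cseq_convex V" "V \<subseteq> U"
    using X U unfolding lc_hausdorff_def by blast
  obtain r where r: "r > 0" "A \<subseteq> cscale (of_real r) ` V"
    using A V unfolding bounded_in_def by blast
  obtain q where q: "q > 0" "B \<subseteq> cscale (of_real q) ` V"
    using B V unfolding bounded_in_def by blast
  have mono: "cscale (of_real a) ` V \<subseteq> cscale (of_real b) ` V" if ab: "0 < a" "a \<le> b" for a b :: real
  proof clarify
    fix v assume v: "v \<in> V"
    have t: "a / b \<in> {0..1}"
      using ab by (auto simp: field_simps)
    have "cscale (of_real (1 - a / b)) 0 + cscale (of_real (a / b)) v \<in> V"
      using V v t unfolding cseq_convex_def zero_nbhd_def by blast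
    moreover have "cscale (of_real a) v =
        cscale (of_real b) (cscale (of_real (1 - a / b)) 0 + cscale (of_real (a / b)) v)"
      using ab by (auto simp: cscale_def fun_eq_iff)
    ultimately show "cscale (of_real a) v \<in> cscale (of_real b) ` V"
      by blast
  qed
  have "A \<union> B \<subseteq> cscale (of_real (max r q)) ` V"
  proof -
    have "cscale (of_real r) ` V \<subseteq> cscale (of_real (max r q)) ` V"
      using r by (intro mono) auto
    moreover have "cscale (of_real q) ` V \<subseteq> cscale (of_real (max r q)) ` V"
      using q by (intro mono) auto
    ultimately show ?thesis
      using r(2) q(2) by (meson Un_least subset_trans)
  qed
  moreover have "cscale (of_real (max r q)) ` V \<subseteq> cscale (of_real (max r q)) ` U"
    using V by blast
  ultimately show "\<exists>r>0. A \<union> B \<subseteq> cscale (of_real r) ` U"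
    using r by (intro exI[of _ "max r q"] conjI) (simp, rule subset_trans)
qed

lemma openin_Lb_topology:
  assumes "lc_hausdorff X"
  shows "openin (Lb_topology X) W \<longleftrightarrow> Lb_open X W"
proof -
  have "Lb_open X (W \<inter> W')" if W: "Lb_open X W" and W': "Lb_open X W'" for W W'
    unfolding Lb_open_def
  proof (intro conjI ballI)
    show "W \<inter> W' \<subseteq> cont_ops X"
      using W by (auto simp: Lb_open_def)
  next
    fix S assume S: "S \<in> W \<inter> W'"
    obtain B V where 1: "bounded_in X B" "zero_nbhd X V"
        "{R \<in> cont_ops X. \<forall>x\<in>B. R x - S x \<in> V} \<subseteq> W"
      using W S unfolding Lb_open_def by blast
    obtain B' V' where 2: "bounded_in X B'" "zero_nbhd X V'"
        "{R \<in> cont_ops X. \<forall>x\<in>B'. R x - S x \<in> V'} \<subseteq> W'"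
      using W' S unfolding Lb_open_def by blast
    have "{R \<in> cont_ops X. \<forall>x\<in>B \<union> B'. R x - S x \<in> V \<inter> V'} \<subseteq> W \<inter> W'"
      using 1 2 by blast
    then show "\<exists>B V. bounded_in X B \<and> zero_nbhd X V \<and>
        {R \<in> cont_ops X. \<forall>x\<in>B. R x - S x \<in> V} \<subseteq> W \<inter> W'"
      using bounded_in_Un[OF assms 1(1) 2(1)] zero_nbhd_Int[OF 1(2) 2(2)] by blast
  qed
  moreover have "Lb_open X (\<Union>\<K>)" if K: "\<forall>W\<in>\<K>. Lb_open X W" for \<K>
    unfolding Lb_open_def
  proof (intro conjI ballI)
    show "\<Union>\<K> \<subseteq> cont_ops X"
      using K by (auto simp: Lb_open_def)
  next
    fix S assume "S \<in> \<Union>\<K>"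
    then obtain W where W: "W \<in> \<K>" "S \<in> W" by blast
    then obtain B V where "bounded_in X B" "zero_nbhd X V"
        "{R \<in> cont_ops X. \<forall>x\<in>B. R x - S x \<in> V} \<subseteq> W"
      using K unfolding Lb_open_def by blast
    then show "\<exists>B V. bounded_in X B \<and> zero_nbhd X V \<and>
        {R \<in> cont_ops X. \<forall>x\<in>B. R x - S x \<in> V} \<subseteq> \<Union>\<K>"
      using W(1) by blast
  qed
  ultimately have "istopology (Lb_open X)"
    by (simp add: istopology_def)
  then show ?thesis
    by (simp add: Lb_topology_def)
qed


section \<open>Weighted spaces and their inductive limits\<close>

definition c0 :: "(nat \<Rightarrow> real) \<Rightarrow> cseq set" where
  "c0 w = {x. (\<lambda>n. w n * cmod (x n)) \<longlonglongrightarrow> 0}"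

definition c0_norm :: "(nat \<Rightarrow> real) \<Rightarrow> cseq \<Rightarrow> real" where
  "c0_norm w x = (SUP n. w n * cmod (x n))"

text \<open>The absolute value is redundant on \<^term>\<open>c0 w\<close>; \<^locale>\<open>Metric_space\<close> demands a distance
  that is nonnegative on the whole type.\<close>

definition c0_topology :: "(nat \<Rightarrow> real) \<Rightarrow> cseq topology" where
  "c0_topology w = Metric_space.mtopology (c0 w) (\<lambda>x y. \<bar>c0_norm w (x - y)\<bar>)"

definition ind_admissible :: "(nat \<Rightarrow> nat \<Rightarrow> real) \<Rightarrow> cseq topology \<Rightarrow> bool" where
  "ind_admissible w X \<longleftrightarrow>
     topspace X = (\<Union>k. c0 (w k)) \<and> lc_hausdorff X \<and>
     (\<forall>k. continuous_map (c0_topology (w k)) X (\<lambda>x. x))"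

definition is_ind_topology :: "(nat \<Rightarrow> nat \<Rightarrow> real) \<Rightarrow> cseq topology \<Rightarrow> bool" where
  "is_ind_topology w X \<longleftrightarrow>
     ind_admissible w X \<and> (\<forall>Y. ind_admissible w Y \<longrightarrow> (\<forall>U. openin Y U \<longrightarrow> openin X U))"

definition ind_topology :: "(nat \<Rightarrow> nat \<Rightarrow> real) \<Rightarrow> cseq topology" where
  "ind_topology w = (THE X. is_ind_topology w X)"

definition v_weight :: "(nat \<Rightarrow> real) \<Rightarrow> (nat \<Rightarrow> real) \<Rightarrow> nat \<Rightarrow> nat \<Rightarrow> real" where
  "v_weight \<alpha> s k n = s k powr (- \<alpha> n)"

definition E_space :: "(nat \<Rightarrow> real) \<Rightarrow> (nat \<Rightarrow> real) \<Rightarrow> cseq set" where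
  "E_space \<alpha> s = (\<Union>k. c0 (v_weight \<alpha> s k))"

definition E_topology :: "(nat \<Rightarrow> real) \<Rightarrow> (nat \<Rightarrow> real) \<Rightarrow> cseq topology" where
  "E_topology \<alpha> s = ind_topology (v_weight \<alpha> s)"

definition cesaro :: "cseq \<Rightarrow> cseq" where
  "cesaro x = (\<lambda>n. (\<Sum>i\<le>n. x i) / of_nat (n + 1))"

definition unit_seq :: "nat \<Rightarrow> cseq" where
  "unit_seq n = (\<lambda>k. if k = n then 1 else 0)"


section \<open>Existence and uniqueness of the inductive limit topology\<close>

lemma c0_bdd_above:
  assumes "x \<in> c0 w"
  shows "bdd_above (range (\<lambda>n. w n * cmod (x n)))"
  using assms unfolding c0_def
  by (intro Bseq_bdd_above convergent_imp_Bseq) (auto simp: convergent_def)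

lemma c0_norm_upper: "x \<in> c0 w \<Longrightarrow> w n * cmod (x n) \<le> c0_norm w x"
  unfolding c0_norm_def by (intro cSUP_upper c0_bdd_above) auto

lemma c0_add:
  assumes w: "\<And>n. 0 < w n" and x: "x \<in> c0 w" and y: "y \<in> c0 w"
  shows "x + y \<in> c0 w"
proof -
  have "(\<lambda>n. w n * cmod (x n) + w n * cmod (y n)) \<longlonglongrightarrow> 0 + 0"
    using x y unfolding c0_def by (intro tendsto_add) auto
  then have lim: "(\<lambda>n. w n * cmod (x n) + w n * cmod (y n)) \<longlonglongrightarrow> 0" by simp
  have le: "w n * cmod ((x + y) n) \<le> w n * cmod (x n) + w n * cmod (y n)" for n
    using mult_left_mono[OF norm_triangle_ineq[of "x n" "y n"] less_imp_le[OF w[of n]]]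
    by (simp add: distrib_left)
  have "(\<lambda>n. w n * cmod ((x + y) n)) \<longlonglongrightarrow> 0"
    by (rule tendsto_sandwich[OF _ _ tendsto_const lim])
       (use le w in \<open>auto intro!: always_eventually simp: less_imp_le\<close>)
  then show ?thesis by (simp add: c0_def)
qed

lemma c0_scale:
  assumes "x \<in> c0 w"
  shows "cscale c x \<in> c0 w"
proof -
  have "(\<lambda>n. cmod c * (w n * cmod (x n))) \<longlonglongrightarrow> cmod c * 0"
    using assms unfolding c0_def by (intro tendsto_mult) auto
  then show ?thesis
    by (simp add: c0_def cscale_def norm_mult mult.left_commute)
qed

lemma c0_diff:
  assumes "\<And>n. 0 < w n" "x \<in> c0 w" "y \<in> c0 w"
  shows "x - y \<in> c0 w"
proof -
  have eq: "x - y = x + cscale (-1) y"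
    by (auto simp: cscale_def fun_eq_iff)
  show ?thesis
    unfolding eq by (rule c0_add[OF assms(1,2) c0_scale[OF assms(3)]])
qed

lemma zero_in_c0: "0 \<in> c0 w"
  by (simp add: c0_def)

lemma subspace_c0: "(\<And>n. 0 < w n) \<Longrightarrow> cseq.subspace (c0 w)"
  unfolding cseq.subspace_def by (intro conjI ballI allI c0_add c0_scale zero_in_c0)

lemma Metric_space_c0:
  assumes w: "\<And>n. 0 < w n"
  shows "Metric_space (c0 w) (\<lambda>x y. \<bar>c0_norm w (x - y)\<bar>)"
proof
  have nn: "0 \<le> c0_norm w (x - y)" if "x \<in> c0 w" "y \<in> c0 w" for x y
  proof -
    have "0 \<le> w 0 * cmod ((x - y) 0)"
      using w[of 0] by simp
    also have "\<dots> \<le> c0_norm w (x - y)"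
      using that by (intro c0_norm_upper c0_diff w)
    finally show ?thesis .
  qed
  show "0 \<le> \<bar>c0_norm w (x - y)\<bar>" for x y
    by simp
  show "\<bar>c0_norm w (x - y)\<bar> = \<bar>c0_norm w (y - x)\<bar>" for x y
    by (simp add: c0_norm_def norm_minus_commute)
  show "\<bar>c0_norm w (x - y)\<bar> = 0 \<longleftrightarrow> x = y" if x: "x \<in> c0 w" and y: "y \<in> c0 w" for x y
  proof
    assume 0: "\<bar>c0_norm w (x - y)\<bar> = 0"
    have "w n * cmod ((x - y) n) \<le> 0" for n
      using c0_norm_upper[OF c0_diff[OF w x y], of n] 0 by simp
    then have "cmod ((x - y) n) = 0" for n
      using w[of n] by (smt (verit) mult_pos_pos norm_ge_zero)
    then show "x = y" by (simp add: fun_eq_iff)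
  qed (simp add: c0_norm_def)
  show "\<bar>c0_norm w (x - z)\<bar> \<le> \<bar>c0_norm w (x - y)\<bar> + \<bar>c0_norm w (y - z)\<bar>"
    if x: "x \<in> c0 w" and y: "y \<in> c0 w" and z: "z \<in> c0 w" for x y z
  proof -
    have "c0_norm w (x - z) \<le> c0_norm w (x - y) + c0_norm w (y - z)"
      unfolding c0_norm_def[of w "x - z"]
    proof (rule cSUP_least)
      fix n
      have "cmod ((x - z) n) \<le> cmod ((x - y) n) + cmod ((y - z) n)"
        using norm_triangle_ineq[of "x n - y n" "y n - z n"] by simp
      then have "w n * cmod ((x - z) n) \<le> w n * (cmod ((x - y) n) + cmod ((y - z) n))"
        using w[of n] by (intro mult_left_mono) auto
      also have "\<dots> = w n * cmod ((x - y) n) + w n * cmod ((y - z) n)"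
        by (rule distrib_left)
      also have "\<dots> \<le> c0_norm w (x - y) + c0_norm w (y - z)"
        by (intro add_mono c0_norm_upper c0_diff w x y z)
      finally show "w n * cmod ((x - z) n) \<le> c0_norm w (x - y) + c0_norm w (y - z)" .
    qed simp
    then show ?thesis
      using nn x y z by simp
  qed
qed

lemma c0_antimono:
  assumes w: "\<And>n. 0 < w n" and le: "\<And>n. w n \<le> w' n" and x: "x \<in> c0 w'"
  shows "x \<in> c0 w"
proof -
  have lim: "(\<lambda>n. w' n * cmod (x n)) \<longlonglongrightarrow> 0"
    using x by (simp add: c0_def)
  have "(\<lambda>n. w n * cmod (x n)) \<longlonglongrightarrow> 0"
  proof (rule tendsto_sandwich[OF _ _ tendsto_const lim])
    show "\<forall>\<^sub>F n in sequentially. 0 \<le> w n * cmod (x n)"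
      using w by (auto intro!: always_eventually simp: less_imp_le)
    show "\<forall>\<^sub>F n in sequentially. w n * cmod (x n) \<le> w' n * cmod (x n)"
      using le by (auto intro!: always_eventually mult_right_mono)
  qed
  then show ?thesis by (simp add: c0_def)
qed

lemma topspace_c0_topology:
  assumes "\<And>n. 0 < w n"
  shows "topspace (c0_topology w) = c0 w"
  unfolding c0_topology_def
  by (rule Metric_space.topspace_mtopology[OF Metric_space_c0[OF assms]])

lemma continuous_map_c0_coordinate:
  assumes w: "\<And>n. 0 < w n"
  shows "continuous_map (c0_topology w) euclidean (\<lambda>x. x n)"
proof -
  interpret Metric_space "c0 w" "\<lambda>x y. \<bar>c0_norm w (x - y)\<bar>"
    by (rule Metric_space_c0[OF w])
  show ?thesis
    unfolding continuous_map_def topspace_c0_topology[OF w]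
  proof (intro conjI allI impI)
    fix O' :: "complex set" assume O': "openin euclidean O'"
    show "openin (c0_topology w) {x \<in> c0 w. x n \<in> O'}"
      unfolding c0_topology_def openin_mtopology
    proof (intro conjI allI impI)
      fix x assume x: "x \<in> {x \<in> c0 w. x n \<in> O'}"
      then obtain e where e: "e > 0" "ball (x n) e \<subseteq> O'"
        using O' open_contains_ball by (metis mem_Collect_eq open_openin)
      have "mball x (w n * e) \<subseteq> {x \<in> c0 w. x n \<in> O'}"
      proof
        fix y assume "y \<in> mball x (w n * e)"
        then have xy: "x \<in> c0 w" "y \<in> c0 w" "\<bar>c0_norm w (x - y)\<bar> < w n * e"
          by auto
        then have "w n * cmod ((x - y) n) < w n * e"
          using c0_norm_upper[OF c0_diff[OF w xy(1,2)], of n] by linarith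
        then have "cmod ((x - y) n) < e"
          using w[of n] by (simp only: mult_less_cancel_left_pos)
        then have "y n \<in> ball (x n) e"
          by (simp add: dist_norm)
        then show "y \<in> {x \<in> c0 w. x n \<in> O'}"
          using e xy by auto
      qed
      then show "\<exists>r>0. mball x r \<subseteq> {x \<in> c0 w. x n \<in> O'}"
        using e(1) w[of n] by (intro exI[of _ "w n * e"]) auto
    qed auto
  qed auto
qed

lemma pointwise_lc_hausdorff:
  assumes E: "cseq.subspace E"
  shows "lc_hausdorff (subtopology euclidean E)"
  unfolding lc_hausdorff_def
proof (intro conjI allI impI)
  show "cseq.subspace (topspace (subtopology euclidean E))"
    using E by simp
  have "continuous_on (E \<times> E) (\<lambda>p. fst p + snd p)"
    unfolding plus_fun_def
    by (intro continuous_on_coordinatewise_then_product continuous_on_add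
        continuous_on_product_then_coordinatewise[OF continuous_on_fst[OF continuous_on_id]]
        continuous_on_product_then_coordinatewise[OF continuous_on_snd[OF continuous_on_id]])
  then have "continuous_on (E \<times> E) (\<lambda>(x, y). x + y)"
    by (simp add: case_prod_unfold)
  then show "continuous_map (prod_topology (subtopology euclidean E) (subtopology euclidean E))
      (subtopology euclidean E) (\<lambda>(x, y). x + y)"
    using E by (auto simp: continuous_map_in_subtopology subtopology_Times[symmetric]
        cseq.subspace_def)
  have "continuous_on (UNIV \<times> E) (\<lambda>p. cscale (fst p) (snd p))"
    unfolding cscale_def
    by (intro continuous_on_coordinatewise_then_product continuous_on_mult continuous_on_fst[OF continuous_on_id]
        continuous_on_product_then_coordinatewise[OF continuous_on_snd[OF continuous_on_id]])
  then have "continuous_on (UNIV \<times> E) (\<lambda>(c, x). cscale c x)"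
    by (simp add: case_prod_unfold)
  moreover have "prod_topology euclidean (subtopology euclidean E) =
      subtopology euclidean ((UNIV :: complex set) \<times> E)"
    by (metis euclidean_product_topology prod_topology_subtopology_eu subtopology_UNIV)
  ultimately show "continuous_map (prod_topology euclidean (subtopology euclidean E))
      (subtopology euclidean E) (\<lambda>(c, x). cscale c x)"
    using E by (auto simp: continuous_map_in_subtopology cseq.subspace_def)
  show "Hausdorff_space (subtopology (euclidean :: cseq topology) E)"
    by (simp add: Hausdorff_space_subtopology)
next
  fix U assume "zero_nbhd (subtopology euclidean E) U"
  then obtain G where G: "open G" "U = E \<inter> G" and z: "0 \<in> U"
    unfolding zero_nbhd_def openin_open by blast
  have "openin (product_topology (\<lambda>_. euclidean) UNIV) G"
    using G by (simp add: open_fun_def)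
  from product_topology_open_contains_basis[OF this] obtain X where
    X: "0 \<in> (\<Pi>\<^sub>E i\<in>UNIV. X i)" "\<And>i. openin euclidean (X i)"
       "finite {i. X i \<noteq> topspace (euclidean :: complex topology)}" "(\<Pi>\<^sub>E i\<in>UNIV. X i) \<subseteq> G"
    using z G by blast
  define F where "F = {i. X i \<noteq> UNIV}"
  have F: "finite F" using X(3) by (simp add: F_def)
  have "\<exists>e>0. ball 0 e \<subseteq> X i" for i
  proof -
    have "0 i \<in> X i" using X(1) by auto
    then show ?thesis
      using X(2)[of i] open_contains_ball[of "X i"] by (auto simp: open_openin[symmetric])
  qed
  then obtain e where e: "\<And>i. 0 < e i" "\<And>i. ball 0 (e i) \<subseteq> X i"
    by metis
  define V where "V = E \<inter> (\<Inter>i\<in>F. (\<lambda>x::cseq. x i) -` ball 0 (e i))"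
  have op: "open (\<Inter>i\<in>F. (\<lambda>x::cseq. x i) -` ball 0 (e i))"
  proof (intro open_INT F ballI open_vimage open_ball)
    show "continuous_on UNIV (\<lambda>x::cseq. x i)" for i
      by (rule continuous_on_product_coordinates)
  qed
  have "0 \<in> V"
    using E e(1) by (auto simp: V_def cseq.subspace_def)
  then have nb: "zero_nbhd (subtopology euclidean E) V"
    unfolding zero_nbhd_def V_def using openin_open_Int[OF op] by auto
  have cv: "cseq_convex V"
    unfolding cseq_convex_def
  proof (intro ballI)
    fix x y :: cseq and t :: real
    assume xy: "x \<in> V" "y \<in> V" and t: "t \<in> {0..1}"
    have "cscale (of_real (1 - t)) x + cscale (of_real t) y \<in> E"
      using xy E unfolding V_def cseq.subspace_def by blast
    moreover have "(cscale (of_real (1 - t)) x + cscale (of_real t) y) i \<in> ball 0 (e i)" if "i \<in> F" for i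
    proof -
      have "x i \<in> ball 0 (e i)" "y i \<in> ball 0 (e i)"
        using xy that by (auto simp: V_def)
      then have "(1 - t) *\<^sub>R x i + t *\<^sub>R y i \<in> ball 0 (e i)"
        using t by (intro convexD[OF convex_ball]) auto
      then show ?thesis
        by (simp add: cscale_def scaleR_conv_of_real)
    qed
    ultimately show "cscale (of_real (1 - t)) x + cscale (of_real t) y \<in> V"
      by (auto simp: V_def)
  qed
  have "V \<subseteq> U"
  proof
    fix x assume x: "x \<in> V"
    have "x i \<in> X i" for i
    proof (cases "i \<in> F")
      case True
      then have "x i \<in> ball 0 (e i)"
        using x by (simp add: V_def)
      then show ?thesis
        using e(2) by blast
    next
      case False
      then show ?thesis by (simp add: F_def)
    qed
    then have "x \<in> G" using X(4) by auto
    then show "x \<in> U" using x G by (auto simp: V_def)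
  qed
  then show "\<exists>V. zero_nbhd (subtopology euclidean E) V \<and> cseq_convex V \<and> V \<subseteq> U"
    using nb cv by blast
qed

lemma continuous_map_into_generated:
  assumes "\<And>x. x \<in> topspace X \<Longrightarrow> f x \<in> \<Union>\<S>"
    and "\<And>U. U \<in> \<S> \<Longrightarrow> openin X (f -` U \<inter> topspace X)"
  shows "continuous_map X (topology_generated_by \<S>) f"
  using assms by (intro continuous_on_generated_topo) auto

lemma continuous_map_finer:
  assumes "continuous_map X Y f" "topspace X' = topspace X" "\<And>U. openin X U \<Longrightarrow> openin X' U"
  shows "continuous_map X' Y f"
  using assms by (auto simp: continuous_map_def)

lemma prod_topology_finer:
  assumes "\<And>U. openin X U \<Longrightarrow> openin X' U" "\<And>U. openin Y U \<Longrightarrow> openin Y' U"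
    and "openin (prod_topology X Y) W"
  shows "openin (prod_topology X' Y') W"
  using assms(3) unfolding openin_prod_topology_alt
  by (meson assms(1,2))

theorem ex1_is_ind_topology:
  assumes pos: "\<And>k n. 0 < w k n" and dec: "\<And>k n. w (Suc k) n \<le> w k n"
  shows "\<exists>!X. is_ind_topology w X"
proof -
  define E where "E = (\<Union>k. c0 (w k))"
  have mono: "c0 (w j) \<subseteq> c0 (w k)" if "j \<le> k" for j k
  proof
    have "w k n \<le> w j n" for n
      by (rule lift_Suc_antimono_le[of "\<lambda>k. w k n", OF dec that])
    then show "x \<in> c0 (w k)" if "x \<in> c0 (w j)" for x
      using c0_antimono[of "w k" "w j", OF pos] that by blast
  qed
  have E: "cseq.subspace E"
    unfolding cseq.subspace_def
  proof (intro conjI ballI allI)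
    show "0 \<in> E" by (auto simp: E_def zero_in_c0)
    show "cscale c x \<in> E" if "x \<in> E" for c x
      using that by (auto simp: E_def intro: c0_scale)
    fix x y assume "x \<in> E" "y \<in> E"
    then obtain j k where "x \<in> c0 (w j)" "y \<in> c0 (w k)" by (auto simp: E_def)
    then have "x \<in> c0 (w (max j k))" "y \<in> c0 (w (max j k))"
      using mono[of j "max j k"] mono[of k "max j k"] by auto
    then have "x + y \<in> c0 (w (max j k))"
      by (rule c0_add[OF pos])
    then show "x + y \<in> E" by (auto simp: E_def)
  qed
  have pw: "ind_admissible w (subtopology euclidean E)"
    unfolding ind_admissible_def
  proof (intro conjI allI)
    show "topspace (subtopology euclidean E) = (\<Union>k. c0 (w k))" by (simp add: E_def)
    show "lc_hausdorff (subtopology euclidean E)" by (rule pointwise_lc_hausdorff[OF E])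
    fix k
    have "continuous_map (c0_topology (w k)) (product_topology (\<lambda>_. euclidean) UNIV) (\<lambda>x. x)"
      unfolding continuous_map_componentwise_UNIV
      by (intro allI continuous_map_c0_coordinate pos)
    then show "continuous_map (c0_topology (w k)) (subtopology euclidean E) (\<lambda>x. x)"
      by (auto simp: continuous_map_in_subtopology euclidean_product_topology
          topspace_c0_topology[OF pos] E_def)
  qed
  define \<S> where "\<S> = {U. \<exists>Y. ind_admissible w Y \<and> openin Y U}"
  define X where "X = topology_generated_by \<S>"
  have sub: "topspace Y = E" if "ind_admissible w Y" for Y
    using that by (simp add: ind_admissible_def E_def)
  have "E \<in> \<S>"
    using pw sub[OF pw] openin_topspace unfolding \<S>_def by fastforce
  moreover have "U \<subseteq> E" if "U \<in> \<S>" for U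
    using that sub openin_subset unfolding \<S>_def by blast
  ultimately have US: "\<Union>\<S> = E" by blast
  have top: "topspace X = E"
    by (simp add: X_def US)
  have finer: "openin X U" if "ind_admissible w Y" "openin Y U" for Y U
    unfolding X_def by (rule topology_generated_by_Basis) (use that in \<open>auto simp: \<S>_def\<close>)
  have into: "continuous_map Z X f"
    if Z: "\<And>Y. ind_admissible w Y \<Longrightarrow> continuous_map Z Y f" for Z :: "'z topology" and f
    unfolding X_def
  proof (rule continuous_map_into_generated)
    show "f x \<in> \<Union>\<S>" if "x \<in> topspace Z" for x
      using continuous_map_funspace[OF Z[OF pw]] that sub[OF pw] US by auto
    fix U assume "U \<in> \<S>"
    then obtain Y where Y: "ind_admissible w Y" "openin Y U" by (auto simp: \<S>_def)
    have "{x \<in> topspace Z. f x \<in> U} = f -` U \<inter> topspace Z" by blast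
    then show "openin Z (f -` U \<inter> topspace Z)"
      using openin_continuous_map_preimage[OF Z[OF Y(1)] Y(2)] by simp
  qed
  have adm: "ind_admissible w X"
    unfolding ind_admissible_def lc_hausdorff_def
  proof (intro conjI allI impI)
    show "topspace X = (\<Union>k. c0 (w k))" by (simp add: top E_def)
    show "cseq.subspace (topspace X)" by (simp add: top E)
    show "continuous_map (prod_topology X X) X (\<lambda>(x, y). x + y)"
    proof (rule into)
      fix Y assume Y: "ind_admissible w Y"
      show "continuous_map (prod_topology X X) Y (\<lambda>(x, y). x + y)"
      proof (rule continuous_map_finer)
        show "continuous_map (prod_topology Y Y) Y (\<lambda>(x, y). x + y)"
          using Y by (simp add: ind_admissible_def lc_hausdorff_def)
        show "openin (prod_topology Y Y) U \<Longrightarrow> openin (prod_topology X X) U" for U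
          by (rule prod_topology_finer[OF finer[OF Y] finer[OF Y]])
      qed (simp add: top sub[OF Y])
    qed
    show "continuous_map (prod_topology euclidean X) X (\<lambda>(c, x). cscale c x)"
    proof (rule into)
      fix Y assume Y: "ind_admissible w Y"
      show "continuous_map (prod_topology euclidean X) Y (\<lambda>(c, x). cscale c x)"
      proof (rule continuous_map_finer)
        show "continuous_map (prod_topology euclidean Y) Y (\<lambda>(c, x). cscale c x)"
          using Y by (simp add: ind_admissible_def lc_hausdorff_def)
        show "openin (prod_topology euclidean Y) U \<Longrightarrow> openin (prod_topology euclidean X) U"
          for U :: "(complex \<times> cseq) set"
          by (rule prod_topology_finer[OF _ finer[OF Y]])
      qed (simp add: top sub[OF Y])
    qed
    show "Hausdorff_space X"
      unfolding Hausdorff_space_def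
    proof (intro allI impI)
      fix x y assume "x \<in> topspace X \<and> y \<in> topspace X \<and> x \<noteq> y"
      then obtain U V where "openin (subtopology euclidean E) U" "openin (subtopology euclidean E) V"
          "x \<in> U" "y \<in> V" "disjnt U V"
        using pw sub[OF pw] top unfolding ind_admissible_def lc_hausdorff_def Hausdorff_space_def
        by metis
      then show "\<exists>U V. openin X U \<and> openin X V \<and> x \<in> U \<and> y \<in> V \<and> disjnt U V"
        using finer[OF pw] by blast
    qed
    show "continuous_map (c0_topology (w k)) X (\<lambda>x. x)" for k
      by (rule into) (simp add: ind_admissible_def)
  next
    fix U assume U: "zero_nbhd X U"
    have "0 \<in> U \<longrightarrow> (\<exists>V. zero_nbhd X V \<and> cseq_convex V \<and> V \<subseteq> U)"
      if "generate_topology_on \<S> U" for U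
      using that
    proof induction
      case Empty
      then show ?case by simp
    next
      case (Int A B)
      show ?case
      proof
        assume "0 \<in> A \<inter> B"
        then obtain V V' where "zero_nbhd X V" "cseq_convex V" "V \<subseteq> A"
            "zero_nbhd X V'" "cseq_convex V'" "V' \<subseteq> B"
          using Int.IH by blast
        then have "zero_nbhd X (V \<inter> V')" "cseq_convex (V \<inter> V')" "V \<inter> V' \<subseteq> A \<inter> B"
          using zero_nbhd_Int by (auto simp: cseq_convex_def)
        then show "\<exists>V. zero_nbhd X V \<and> cseq_convex V \<and> V \<subseteq> A \<inter> B" by blast
      qed
    next
      case (UN K)
      then show ?case by blast
    next
      case (Basis A)
      then obtain Y where Y: "ind_admissible w Y" "openin Y A" by (auto simp: \<S>_def)
      show ?case
      proof
        assume "0 \<in> A"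
        then have "zero_nbhd Y A" using Y by (simp add: zero_nbhd_def)
        then obtain V where "zero_nbhd Y V" "cseq_convex V" "V \<subseteq> A"
          using Y unfolding ind_admissible_def lc_hausdorff_def by blast
        then show "\<exists>V. zero_nbhd X V \<and> cseq_convex V \<and> V \<subseteq> A"
          using finer[OF Y(1)] unfolding zero_nbhd_def by blast
      qed
    qed
    moreover have "generate_topology_on \<S> U" "0 \<in> U"
      using U unfolding zero_nbhd_def X_def by (auto simp: openin_topology_generated_by)
    ultimately show "\<exists>V. zero_nbhd X V \<and> cseq_convex V \<and> V \<subseteq> U" by blast
  qed
  show ?thesis
  proof (rule ex1I[of _ X])
    show "is_ind_topology w X"
      using adm finer unfolding is_ind_topology_def by blast
    fix Z assume Z: "is_ind_topology w Z"
    have "openin Z U \<longleftrightarrow> openin X U" for U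
      using Z adm finer unfolding is_ind_topology_def by blast
    then show "Z = X" by (simp add: topology_eq)
  qed
qed

lemma is_ind_topology_E_topology:
  assumes "\<And>n. 0 < \<alpha> n" "\<And>k. 1 < s k" "strict_mono s"
  shows "is_ind_topology (v_weight \<alpha> s) (E_topology \<alpha> s)"
  unfolding E_topology_def ind_topology_def
proof (rule theI'[OF ex1_is_ind_topology])
  have s: "0 < s k" for k
    using assms(2)[of k] by simp
  show "0 < v_weight \<alpha> s k n" for k n
    using s[of k] by (simp add: v_weight_def)
  show "v_weight \<alpha> s (Suc k) n \<le> v_weight \<alpha> s k n" for k n
    using s[of k] assms(1)[of n] strict_mono_leD[OF assms(3), of k "Suc k"]
    by (auto simp: v_weight_def intro!: powr_mono2')
qed

lemma topspace_E_topology: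
  assumes "\<And>n. 0 < \<alpha> n" "\<And>k. 1 < s k" "strict_mono s"
  shows "topspace (E_topology \<alpha> s) = E_space \<alpha> s"
  using is_ind_topology_E_topology[OF assms]
  by (simp add: is_ind_topology_def ind_admissible_def E_space_def)

end

theory Submission
  imports Defs
begin

text \<open>
  Everything rests on a description of the inductive limit topology by weighted supremum seminorms.
  Call a positive decreasing weight \<open>w\<close> rapid if \<open>w n \<le> t powr (- \<alpha> n)\<close> holds eventually for
  every \<open>t > 0\<close>. An element of \<open>E\<close> grows at most like \<open>t powr \<alpha> n\<close> for some \<open>t\<close>, so that
  \<open>w n * cmod (x n)\<close> tends to zero for each rapid \<open>w\<close>. The seminorms \<open>sup w n * cmod (x n)\<close> are
  continuous on every step of the inductive limit, and so they define a locally convex Hausdorff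
  topology that is coarser than the inductive limit topology. Conversely, a convex neighbourhood of zero contains a ball of
  every step, and a minimum of suitable multiples of the weights \<open>v k\<close> is a rapid weight whose unit
  ball lies in the neighbourhood (\<open>zero_nbhd_X_contains_wball\<close>). Hence the two topologies are equal
  (\<open>openin_X_iff\<close>), and continuity, boundedness and closures in \<open>E\<close> are questions about weighted
  absolute values of single entries.

  Averaging does not increase the supremum of \<open>w n * cmod (x n)\<close> if \<open>w\<close> decreases. All powers of the
  operator therefore map the ball of a rapid weight into itself, which gives continuity and power
  boundedness.

  For the ergodic theorem, consider the deviation of the powers of the operator at \<open>x\<close> from the
  constant sequence \<open>x 0\<close>. The first entry never changes, so each average up to index \<open>j\<close> contains a
  deviation that vanishes, and one step shrinks the deviation on \<open>{..j}\<close> by the factor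
  \<open>j / (j + 1)\<close>. The geometric series bounds the deviation of the \<open>n\<close>-th mean at \<open>j\<close> by
  \<open>min 1 (j / n)\<close> times that of \<open>x\<close> on \<open>{..j}\<close> (\<open>norm_ergodic_mean_diff_le\<close>). As \<open>sqrt w\<close> is rapid
  together with \<open>w\<close>, a bounded set satisfies \<open>sqrt (w j) * cmod (x j) \<le> r\<close> with a common \<open>r\<close>; the
  remaining factor \<open>sqrt (w j) * min 1 (j / n)\<close> is small for large \<open>j\<close> because \<open>sqrt w\<close> tends to
  zero and for the finitely many other \<open>j\<close> because \<open>n\<close> is large. The limit of the means is the
  projection onto the constants along the sequences with first entry zero, and its continuity is the
  topological direct sum. The fixed points are the constants by induction on the index. Each
  \<open>e\<^sub>n\<close> other than the first lies in the range of \<open>I - C\<close> by an explicit formula, and finite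
  truncations converge in \<open>E\<close>; as \<open>{x \<in> E. x 0 = 0}\<close> is closed and contains the range, both closures
  are equal to it.
\<close>

section \<open>Pointwise estimates for the Cesaro operator\<close>

lemma cseq_sum_apply: "(\<Sum>i\<in>A. f i) n = (\<Sum>i\<in>A. f i n)" for f :: "'i \<Rightarrow> cseq"
  by (induction A rule: infinite_finite_induct) auto

lemma cesaro_add: "cesaro (x + y) = cesaro x + cesaro y"
  by (simp add: cesaro_def fun_eq_iff sum.distrib add_divide_distrib)

lemma cesaro_scale: "cesaro (cscale c x) = cscale c (cesaro x)"
  by (simp add: cesaro_def cscale_def fun_eq_iff sum_distrib_left)

lemma norm_cesaro_le:
  assumes "\<And>i. i \<le> n \<Longrightarrow> cmod (x i) \<le> r"
  shows "cmod (cesaro x n) \<le> r"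
proof -
  have "cmod (\<Sum>i\<le>n. x i) \<le> (\<Sum>i\<le>n. r)"
    using assms by (intro sum_norm_le) auto
  then show ?thesis
    by (simp add: cesaro_def norm_divide divide_le_eq mult.commute del: of_nat_Suc flip: of_nat_Suc)
qed

text \<open>The index \<open>n\<close> carries the smallest weight among the indices \<open>i \<le> n\<close> that enter the
  average, so the bound on the weighted entries bounds each \<open>x i\<close> by \<open>r / w n\<close>.\<close>

lemma weighted_cesaro_le:
  assumes w: "antimono w" "\<And>n. 0 < w n" and x: "\<And>n. w n * cmod (x n) \<le> r"
  shows "w n * cmod (cesaro x n) \<le> r"
proof -
  have "cmod (x i) \<le> r / w n" if "i \<le> n" for i
  proof -
    have "w n * cmod (x i) \<le> w i * cmod (x i)"
      using antimonoD[OF w(1) that] by (rule mult_right_mono) simp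
    also have "\<dots> \<le> r" by (rule x)
    finally show ?thesis
      using w(2)[of n] by (simp add: pos_le_divide_eq mult.commute)
  qed
  then have "cmod (cesaro x n) \<le> r / w n"
    by (rule norm_cesaro_le)
  then show ?thesis
    using w(2)[of n] by (simp add: pos_le_divide_eq mult.commute)
qed

lemma cesaro_pow_0: "(cesaro ^^ m) x 0 = x 0"
  by (induction m) (auto simp: cesaro_def)

text \<open>The deviation at index \<open>0\<close> is zero for every power. An average over \<open>{..j}\<close> thus has at most
  \<open>j\<close> of its \<open>j + 1\<close> terms different from zero, which gains the factor \<open>j / (j + 1)\<close> in every step.\<close>

lemma norm_cesaro_pow_diff_le:
  assumes "\<And>i. i \<le> n \<Longrightarrow> cmod (x i - x 0) \<le> r"
  shows "j \<le> n \<Longrightarrow> cmod ((cesaro ^^ m) x j - x 0) \<le> (real n / real (n + 1)) ^ m * r"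
proof (induction m arbitrary: j)
  case 0
  then show ?case using assms by simp
next
  case (Suc m)
  let ?b = "(real n / real (n + 1)) ^ m * r"
  have r: "0 \<le> r" using assms[of 0] by simp
  have b: "0 \<le> ?b" using r by simp
  have "(cesaro ^^ Suc m) x j - x 0 = (\<Sum>i\<le>j. (cesaro ^^ m) x i - x 0) / of_nat (j + 1)"
    by (simp add: cesaro_def sum_subtractf field_simps del: of_nat_Suc flip: of_nat_Suc)
  also have "(\<Sum>i\<le>j. (cesaro ^^ m) x i - x 0) = (\<Sum>i\<in>{1..j}. (cesaro ^^ m) x i - x 0)"
    by (rule sum.mono_neutral_right) (auto simp: cesaro_pow_0 not_le)
  finally have eq: "cmod ((cesaro ^^ Suc m) x j - x 0)
      = cmod (\<Sum>i\<in>{1..j}. (cesaro ^^ m) x i - x 0) / real (j + 1)"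
    by (simp add: norm_divide del: of_nat_Suc flip: of_nat_Suc)
  have "cmod (\<Sum>i\<in>{1..j}. (cesaro ^^ m) x i - x 0) \<le> (\<Sum>i\<in>{1..j}. ?b)"
    using Suc.IH Suc.prems by (intro sum_norm_le) auto
  then have "cmod ((cesaro ^^ Suc m) x j - x 0) \<le> real j * ?b / real (j + 1)"
    unfolding eq by (intro divide_right_mono) auto
  also have "\<dots> = real j / real (j + 1) * ?b" by simp
  also have "\<dots> \<le> real n / real (n + 1) * ?b"
    using Suc.prems by (intro mult_right_mono[OF _ b]) (simp add: field_simps)
  also have "\<dots> = (real n / real (n + 1)) ^ Suc m * r" by simp
  finally show ?case .
qed

text \<open>With \<open>q = j / (j + 1)\<close> the sum of \<open>q ^ m\<close> over \<open>1 \<le> m \<le> n\<close> is at most \<open>n\<close>, and it is at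
  most \<open>q / (1 - q) = j\<close>. The first bound serves for large \<open>j\<close>, the second one for fixed \<open>j\<close> and large \<open>n\<close>.\<close>

lemma norm_ergodic_mean_diff_le:
  assumes x: "\<And>i. i \<le> j \<Longrightarrow> cmod (x i - x 0) \<le> r" and n: "1 \<le> n"
  shows "cmod (ergodic_mean cesaro n x j - x 0) \<le> min 1 (real j / real n) * r"
proof -
  define q where "q = real j / real (j + 1)"
  have q: "0 \<le> q" "q < 1" by (auto simp: q_def)
  have r: "0 \<le> r" using x[of 0] by simp
  have "ergodic_mean cesaro n x j - x 0 = (\<Sum>m=1..n. (cesaro ^^ m) x j - x 0) / of_nat n"
    using n by (simp add: ergodic_mean_def cscale_def cseq_sum_apply sum_subtractf field_simps)
  then have eq: "cmod (ergodic_mean cesaro n x j - x 0) = cmod (\<Sum>m=1..n. (cesaro ^^ m) x j - x 0) / n"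
    by (simp add: norm_divide)
  have 1: "cmod (\<Sum>m=1..n. (cesaro ^^ m) x j - x 0) \<le> (\<Sum>m=1..n. q ^ m * r)"
    unfolding q_def by (intro sum_norm_le norm_cesaro_pow_diff_le[of j x]) (auto intro: x)
  have "(\<Sum>m=1..n. q ^ m) \<le> (\<Sum>m=1..n. 1)"
    using q by (intro sum_mono) (auto intro: power_le_one)
  moreover have "(\<Sum>m=1..n. q ^ m) \<le> real j"
  proof -
    have "(\<Sum>m=1..n. q ^ m) = q * (\<Sum>m<n. q ^ m)"
      unfolding One_nat_def sum.atLeast1_atMost_eq by (simp add: sum_distrib_left)
    also have "\<dots> = q * ((1 - q ^ n) / (1 - q))"
      using q by (simp add: sum_gp_strict)
    also have "\<dots> \<le> q * (1 / (1 - q))"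
      using q by (intro mult_left_mono divide_right_mono) auto
    also have "\<dots> = real j" by (simp add: q_def field_simps)
    finally show ?thesis .
  qed
  ultimately have "(\<Sum>m=1..n. q ^ m) / n \<le> min 1 (real j / real n)"
    using n by (auto simp: divide_right_mono divide_le_eq)
  then have "(\<Sum>m=1..n. q ^ m) / n * r \<le> min 1 (real j / real n) * r"
    using r by (rule mult_right_mono)
  moreover have "cmod (ergodic_mean cesaro n x j - x 0) \<le> (\<Sum>m=1..n. q ^ m) / n * r"
    unfolding eq using divide_right_mono[OF 1, of "real n"] by (simp add: sum_distrib_right)
  ultimately show ?thesis by linarith
qed

text \<open>If \<open>x\<close> is fixed and equals \<open>x 0\<close> below \<open>n\<close>, the equation at \<open>n\<close> reads
  \<open>(n + 1) * x n = n * x 0 + x n\<close>.\<close>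

lemma cesaro_fixed_iff: "x - cesaro x = 0 \<longleftrightarrow> (\<forall>n. x n = x 0)"
proof
  assume "x - cesaro x = 0"
  then have x: "cesaro x = x" by simp
  show "\<forall>n. x n = x 0"
  proof
    fix n show "x n = x 0"
    proof (induction n rule: less_induct)
      case (less n)
      have "(\<Sum>i\<le>n. x i) = (\<Sum>i<n. x i) + x n"
        by (simp add: lessThan_Suc_atMost[symmetric])
      also have "(\<Sum>i<n. x i) = (\<Sum>i<n. x 0)" by (rule sum.cong[OF refl less.IH]) simp
      also have "\<dots> = of_nat n * x 0" by simp
      finally have sum: "(\<Sum>i\<le>n. x i) = of_nat n * x 0 + x n" .
      have "x n = (\<Sum>i\<le>n. x i) / of_nat (n + 1)"
        using fun_cong[OF x, of n] unfolding cesaro_def by (rule sym)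
      then have "x n * of_nat (n + 1) = of_nat n * x 0 + x n"
        unfolding sum by (metis add_is_0 eq_divide_eq of_nat_eq_0_iff one_neq_zero)
      then have "of_nat n * x n = of_nat n * x 0" by (simp add: distrib_left mult.commute)
      then show ?case by (cases "n = 0") simp_all
    qed
  qed
next
  assume x: "\<forall>n. x n = x 0"
  have "cesaro x n = x n" for n
  proof -
    have "(\<Sum>i\<le>n. x i) = (\<Sum>i\<le>n. x 0)" by (rule sum.cong[OF refl]) (use x in blast)
    then have "cesaro x n = x 0"
      by (simp add: cesaro_def del: of_nat_Suc flip: of_nat_Suc)
    then show ?thesis using x by metis
  qed
  then show "x - cesaro x = 0" by (simp add: fun_eq_iff)
qed

text \<open>The preimage comes from solving the triangular system entry by entry; from the index \<open>n\<close>
  on, the partial sums are \<open>(j + 1) / n\<close> and the averages are constant.\<close>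

lemma unit_seq_eq_diff_cesaro:
  assumes n: "1 \<le> n"
  defines "y \<equiv> \<lambda>k. unit_seq n k + (if n \<le> k then 1 / of_nat n else 0)"
  shows "y - cesaro y = unit_seq n"
proof
  fix j
  show "(y - cesaro y) j = unit_seq n j"
  proof (cases "n \<le> j")
    case True
    have "(\<Sum>i\<le>j. y i) = 1 + (\<Sum>i\<le>j. if n \<le> i then 1 / of_nat n else 0)"
      using True by (simp add: y_def unit_seq_def sum.distrib)
    also have "(\<Sum>i\<le>j. if n \<le> i then 1 / of_nat n else 0 :: complex) = (\<Sum>i\<in>{n..j}. 1 / of_nat n)"
      by (rule sum.mono_neutral_cong_right) auto
    also have "\<dots> = (of_nat (j + 1) - of_nat n) / of_nat n"
      using True by (simp add: of_nat_diff)
    finally have "(\<Sum>i\<le>j. y i) = of_nat (j + 1) / of_nat n"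
      using n by (simp add: field_simps)
    then have "cesaro y j = 1 / of_nat n"
      by (simp add: cesaro_def del: of_nat_Suc flip: of_nat_Suc)
    then show ?thesis using True by (simp add: y_def)
  next
    case False
    then have "cesaro y j = 0" by (simp add: cesaro_def y_def unit_seq_def)
    then show ?thesis using False by (simp add: y_def unit_seq_def)
  qed
qed

text \<open>A finite convex combination written as nested midpoints; the missing mass is put on zero.\<close>

lemma cseq_convex_dyadic_sum:
  assumes V: "cseq_convex V" "0 \<in> V"
  shows "(\<And>k. y k \<in> V) \<Longrightarrow> (\<Sum>k<N. cscale (1 / 2 ^ Suc k) (y k)) \<in> V"
proof (induction N arbitrary: y)
  case 0
  show ?case unfolding lessThan_0 sum.empty by (rule V)
next
  case (Suc N)
  let ?z = "\<Sum>k<N. cscale (1 / 2 ^ Suc k) (y (Suc k))"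
  have "?z \<in> V" by (rule Suc.IH) (rule Suc.prems)
  moreover have "1 / 2 \<in> {0..1::real}" by simp
  ultimately have half: "cscale (of_real (1 - 1 / 2)) (y 0) +
      cscale (of_real (1 / 2)) (\<Sum>k<N. cscale (1 / 2 ^ Suc k) (y (Suc k))) \<in> V"
    using V(1) Suc.prems[of 0] unfolding cseq_convex_def by blast
  have "(\<Sum>k<Suc N. cscale (1 / 2 ^ Suc k) (y k)) = cscale (of_real (1 - 1 / 2)) (y 0) +
      cscale (of_real (1 / 2)) (\<Sum>k<N. cscale (1 / 2 ^ Suc k) (y (Suc k)))"
    unfolding sum.lessThan_Suc_shift
    by (simp add: fun_eq_iff cscale_def cseq_sum_apply sum_distrib_left mult_ac)
  with half show ?case by metis
qed

section \<open>Rapidly decreasing weights\<close>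

text \<open>These are the decreasing positive members of the maximal Nachbin family of the inductive limit,
  that is, of the weights dominated by a multiple of every \<open>v_weight \<alpha> s k\<close>. No multiple appears in the
  condition because a larger \<open>t\<close> absorbs it, and letting \<open>t\<close> range over all positive numbers makes it
  independent of \<open>s\<close>.\<close>

definition rapid_weight :: "(nat \<Rightarrow> real) \<Rightarrow> (nat \<Rightarrow> real) \<Rightarrow> bool" where
  "rapid_weight \<alpha> w \<longleftrightarrow> antimono w \<and> (\<forall>n. 0 < w n) \<and>
     (\<forall>t>0. \<forall>\<^sub>F n in sequentially. w n \<le> t powr (- \<alpha> n))"

lemma rapid_weight_antimono: "rapid_weight \<alpha> w \<Longrightarrow> antimono w"
  and rapid_weight_pos: "rapid_weight \<alpha> w \<Longrightarrow> 0 < w n"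
  and rapid_weight_eventually: "rapid_weight \<alpha> w \<Longrightarrow> 0 < t \<Longrightarrow> \<forall>\<^sub>F n in sequentially. w n \<le> t powr (- \<alpha> n)"
  by (auto simp: rapid_weight_def)

lemma rapid_weight_max:
  assumes "rapid_weight \<alpha> w" "rapid_weight \<alpha> w'"
  shows "rapid_weight \<alpha> (\<lambda>n. max (w n) (w' n))"
  unfolding rapid_weight_def
proof (intro conjI allI impI)
  show "antimono (\<lambda>n. max (w n) (w' n))"
    using assms[THEN rapid_weight_antimono] by (intro antimonoI max.mono) (auto dest: antimonoD)
  show "0 < max (w n) (w' n)" for n
    using rapid_weight_pos[OF assms(1)] by (simp add: less_max_iff_disj)
  show "\<forall>\<^sub>F n in sequentially. max (w n) (w' n) \<le> t powr (- \<alpha> n)" if "0 < t" for t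
    using rapid_weight_eventually[OF assms(1) that] rapid_weight_eventually[OF assms(2) that]
    by eventually_elim simp
qed

text \<open>The condition for \<open>sqrt w\<close> and \<open>t\<close> is the one for \<open>w\<close> and \<open>t\<^sup>2\<close>. This provides a rapid
  weight that is larger than \<open>w\<close> by a factor tending to
  infinity; it takes the part that compactness of the linking maps plays in abstract arguments.\<close>

lemma rapid_weight_sqrt:
  assumes "rapid_weight \<alpha> w"
  shows "rapid_weight \<alpha> (\<lambda>n. sqrt (w n))"
  unfolding rapid_weight_def
proof (intro conjI allI impI)
  show "antimono (\<lambda>n. sqrt (w n))"
    using rapid_weight_antimono[OF assms] by (auto simp: antimono_def)
  show "0 < sqrt (w n)" for n
    using rapid_weight_pos[OF assms] by simp
  fix t :: real assume t: "0 < t"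
  then have "0 < t\<^sup>2" by simp
  from rapid_weight_eventually[OF assms this]
  show "\<forall>\<^sub>F n in sequentially. sqrt (w n) \<le> t powr (- \<alpha> n)"
  proof eventually_elim
    case (elim n)
    have "(t\<^sup>2) powr (- \<alpha> n) = (t powr (- \<alpha> n))\<^sup>2"
      using t by (simp add: power2_eq_square powr_mult)
    then show ?case
      using elim by (intro real_le_lsqrt) auto
  qed
qed

locale power_weights =
  fixes \<alpha> s :: "nat \<Rightarrow> real"
  assumes alpha_pos: "0 < \<alpha> n"
    and strict_mono_alpha: "strict_mono \<alpha>"
    and alpha_at_top: "filterlim \<alpha> at_top sequentially"
    and s_gt_1: "1 < s k"
    and strict_mono_s: "strict_mono s"
    and s_at_top: "filterlim s at_top sequentially"
begin

abbreviation "E \<equiv> E_space \<alpha> s"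
abbreviation "X \<equiv> E_topology \<alpha> s"
abbreviation "v \<equiv> v_weight \<alpha> s"
abbreviation "rapid \<equiv> rapid_weight \<alpha>"

lemma powr_alpha_tendsto_0:
  assumes "0 < q" "q < (1::real)"
  shows "(\<lambda>n. q powr \<alpha> n) \<longlonglongrightarrow> 0"
proof -
  have "filterlim (\<lambda>n. ln q * \<alpha> n) at_bot sequentially"
    using assms by (intro filterlim_tendsto_neg_mult_at_bot[OF tendsto_const _ alpha_at_top]) simp
  then have "(\<lambda>n. exp (ln q * \<alpha> n)) \<longlonglongrightarrow> 0"
    by (rule filterlim_compose[OF exp_at_bot])
  then show ?thesis
    using assms by (simp add: powr_def mult.commute)
qed

text \<open>The quotient of the two sides contains \<open>(t / t') powr \<alpha> n\<close>, which tends to zero. Every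
  constant can thus be absorbed by a larger base, which is used for the weights and for the linking
  maps of the inductive limit.\<close>

lemma eventually_mult_powr_le:
  assumes t: "0 < t" "t < t'"
  shows "\<forall>\<^sub>F n in sequentially. a * t' powr (- \<alpha> n) \<le> t powr (- \<alpha> n)"
proof -
  have "(\<lambda>n. a * (t / t') powr \<alpha> n) \<longlonglongrightarrow> a * 0"
    using t by (intro tendsto_mult tendsto_const powr_alpha_tendsto_0) auto
  then have "\<forall>\<^sub>F n in sequentially. a * (t / t') powr \<alpha> n < 1"
    by (intro order_tendstoD(2)[of _ "a * 0"]) simp_all
  then show ?thesis
  proof eventually_elim
    case (elim n)
    have "a * t' powr (- \<alpha> n) = a * (t / t') powr \<alpha> n * t powr (- \<alpha> n)"
      using t by (simp add: powr_divide powr_minus field_simps)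
    also have "\<dots> \<le> 1 * t powr (- \<alpha> n)"
      using elim by (intro mult_right_mono) auto
    finally show ?case by simp
  qed
qed

lemma v_pos: "0 < v k n"
  using s_gt_1[of k] by (simp add: v_weight_def)

lemma antimono_v: "antimono (v k)"
proof (rule antimonoI)
  fix m n :: nat assume "m \<le> n"
  then have "\<alpha> m \<le> \<alpha> n" by (rule strict_mono_leD[OF strict_mono_alpha])
  then show "v k n \<le> v k m"
    using s_gt_1[of k] by (simp add: v_weight_def powr_mono)
qed

lemma ex_s_gt: "\<exists>k. t < s k"
  using eventually_happens'[OF _ filterlim_at_top_dense[THEN iffD1, OF s_at_top, rule_format, of t]]
  by auto

text \<open>A bound for the base \<open>t\<close> becomes a null sequence for every \<open>s k > t\<close>, so the spaces of
  bounded and of null sequences have the same union.\<close>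

lemma E_iff: "x \<in> E \<longleftrightarrow> (\<exists>t>1. \<exists>M. \<forall>n. t powr (- \<alpha> n) * cmod (x n) \<le> M)"
proof
  assume "x \<in> E"
  then obtain k where "x \<in> c0 (v k)" by (auto simp: E_space_def)
  then show "\<exists>t>1. \<exists>M. \<forall>n. t powr (- \<alpha> n) * cmod (x n) \<le> M"
    using c0_norm_upper[of x "v k"] s_gt_1[of k] by (auto simp: v_weight_def)
next
  assume "\<exists>t>1. \<exists>M. \<forall>n. t powr (- \<alpha> n) * cmod (x n) \<le> M"
  then obtain t M where t: "t > 1" and M: "t powr (- \<alpha> n) * cmod (x n) \<le> M" for n by blast
  obtain k where k: "t < s k" using ex_s_gt by blast
  have "(\<lambda>n. (t / s k) powr \<alpha> n * M) \<longlonglongrightarrow> 0 * M"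
    using t k by (intro tendsto_mult tendsto_const powr_alpha_tendsto_0) auto
  then have lim: "(\<lambda>n. (t / s k) powr \<alpha> n * M) \<longlonglongrightarrow> 0" by simp
  have le: "v k n * cmod (x n) \<le> (t / s k) powr \<alpha> n * M" for n
  proof -
    have "v k n * cmod (x n) = (t / s k) powr \<alpha> n * (t powr (- \<alpha> n) * cmod (x n))"
      using t k by (simp add: v_weight_def powr_divide powr_minus field_simps)
    also have "\<dots> \<le> (t / s k) powr \<alpha> n * M"
      by (intro mult_left_mono M) simp
    finally show ?thesis .
  qed
  have "(\<lambda>n. v k n * cmod (x n)) \<longlonglongrightarrow> 0"
    by (rule tendsto_sandwich[OF _ _ tendsto_const lim])
       (use le v_pos in \<open>auto intro!: always_eventually simp: less_imp_le\<close>)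
  then show "x \<in> E" by (auto simp: E_space_def c0_def)
qed

lemma bounded_in_E: "(\<And>n. cmod (x n) \<le> M) \<Longrightarrow> x \<in> E"
proof -
  assume x: "\<And>n. cmod (x n) \<le> M"
  have "2 powr (- \<alpha> n) * cmod (x n) \<le> 1 * M" for n
    using alpha_pos[of n] by (intro mult_mono x) (auto simp: powr_minus divide_simps ge_one_powr_ge_zero)
  then show ?thesis unfolding E_iff by (intro exI[of _ 2]) auto
qed

lemma rapid_E_subset_c0:
  assumes w: "rapid w"
  shows "E \<subseteq> c0 w"
proof
  fix x assume "x \<in> E"
  then obtain t M where t: "t > 1" and M: "t powr (- \<alpha> n) * cmod (x n) \<le> M" for n
    unfolding E_iff by blast
  have "(\<lambda>n. (1 / 2) powr \<alpha> n * M) \<longlonglongrightarrow> 0 * M"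
    by (intro tendsto_mult tendsto_const powr_alpha_tendsto_0) auto
  then have lim: "(\<lambda>n. (1 / 2) powr \<alpha> n * M) \<longlonglongrightarrow> 0" by simp
  have "\<forall>\<^sub>F n in sequentially. w n * cmod (x n) \<le> (1 / 2) powr \<alpha> n * M"
  proof (rule eventually_mono)
    show "\<forall>\<^sub>F n in sequentially. w n \<le> (2 * t) powr (- \<alpha> n)"
      using t by (intro rapid_weight_eventually[OF w]) simp
    fix n assume elim: "w n \<le> (2 * t) powr (- \<alpha> n)"
    have "w n * cmod (x n) \<le> (2 * t) powr (- \<alpha> n) * cmod (x n)"
      using elim t by (intro mult_right_mono) auto
    also have "\<dots> = (1 / 2) powr \<alpha> n * (t powr (- \<alpha> n) * cmod (x n))"
      using t by (simp add: powr_divide powr_mult powr_minus field_simps)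
    also have "\<dots> \<le> (1 / 2) powr \<alpha> n * M"
      by (intro mult_left_mono M) simp
    finally show "w n * cmod (x n) \<le> (1 / 2) powr \<alpha> n * M" .
  qed
  then have "(\<lambda>n. w n * cmod (x n)) \<longlonglongrightarrow> 0"
    by (intro tendsto_sandwich[OF _ _ tendsto_const lim])
       (use rapid_weight_pos[OF w] in \<open>auto intro!: always_eventually simp: less_imp_le\<close>)
  then show "x \<in> c0 w" by (simp add: c0_def)
qed

lemma rapid_scale:
  assumes w: "rapid w" and r: "0 < r"
  shows "rapid (\<lambda>n. r * w n)"
  unfolding rapid_weight_def
proof (intro conjI allI impI)
  show "antimono (\<lambda>n. r * w n)"
    using rapid_weight_antimono[OF w] r by (auto simp: antimono_def)
  show "0 < r * w n" for n
    using rapid_weight_pos[OF w] r by simp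
  fix t :: real assume t: "0 < t"
  then have "\<forall>\<^sub>F n in sequentially. w n \<le> (2 * t) powr (- \<alpha> n)"
    by (intro rapid_weight_eventually[OF w]) simp
  moreover have "\<forall>\<^sub>F n in sequentially. r * (2 * t) powr (- \<alpha> n) \<le> t powr (- \<alpha> n)"
    using t by (intro eventually_mult_powr_le) auto
  ultimately show "\<forall>\<^sub>F n in sequentially. r * w n \<le> t powr (- \<alpha> n)"
    by eventually_elim (use r in \<open>meson mult_left_mono less_imp_le order_trans\<close>)
qed

text \<open>Only the indices \<open>k \<le> n\<close> enter, which keeps the minimum finite and therefore positive and
  attained; for each \<open>k\<close> this leaves out just the finitely many \<open>n < k\<close>. The set of indices grows
  with \<open>n\<close>, so the minimum still decreases.\<close>

lemma rapid_Min:
  assumes a: "\<And>k. 0 < a k"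
  shows "rapid (\<lambda>n. Min ((\<lambda>k. a k * v k n) ` {..n}))"
  unfolding rapid_weight_def
proof (intro conjI allI impI)
  show "antimono (\<lambda>n. Min ((\<lambda>k. a k * v k n) ` {..n}))"
  proof (rule antimonoI, rule Min.boundedI)
    fix m n b assume mn: "m \<le> n" and "b \<in> (\<lambda>k. a k * v k m) ` {..m}"
    then obtain k where k: "k \<le> m" "b = a k * v k m" by auto
    have "Min ((\<lambda>k. a k * v k n) ` {..n}) \<le> a k * v k n"
      using k mn by (intro Min_le) auto
    also have "\<dots> \<le> b"
      unfolding k using a[of k] antimonoD[OF antimono_v mn] by simp
    finally show "Min ((\<lambda>k. a k * v k n) ` {..n}) \<le> b" .
  qed auto
  show "0 < Min ((\<lambda>k. a k * v k n) ` {..n})" for n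
    using a v_pos by auto
  fix t :: real assume t: "0 < t"
  obtain k where k: "t < s k" using ex_s_gt by blast
  have "\<forall>\<^sub>F n in sequentially. a k * v k n \<le> t powr (- \<alpha> n)"
    unfolding v_weight_def by (rule eventually_mult_powr_le[OF t k])
  then show "\<forall>\<^sub>F n in sequentially. Min ((\<lambda>k. a k * v k n) ` {..n}) \<le> t powr (- \<alpha> n)"
    using eventually_ge_at_top[of k]
  proof eventually_elim
    case (elim n)
    have "Min ((\<lambda>k. a k * v k n) ` {..n}) \<le> a k * v k n"
      using elim by (intro Min_le) auto
    also have "\<dots> \<le> t powr (- \<alpha> n)" using elim by simp
    finally show ?case .
  qed
qed

text \<open>Some initial entries have to be absorbed into the constant; monotonicity reduces them to a
  comparison of \<open>w 0\<close> with \<open>v k N\<close>.\<close>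

lemma rapid_le_v:
  assumes w: "rapid w"
  shows "\<exists>a>0. \<forall>n. w n \<le> a * v k n"
proof -
  have "\<forall>\<^sub>F n in sequentially. w n \<le> v k n"
    using rapid_weight_eventually[OF w, of "s k"] s_gt_1[of k] by (simp add: v_weight_def)
  then obtain N where N: "\<And>n. n \<ge> N \<Longrightarrow> w n \<le> v k n"
    by (auto simp: eventually_sequentially)
  define a where "a = max 1 (w 0 / v k N)"
  have "w n \<le> a * v k n" for n
  proof (cases "n \<ge> N")
    case True
    have "1 * v k n \<le> a * v k n"
      using v_pos[of k n] by (intro mult_right_mono) (auto simp: a_def)
    then show ?thesis using N[OF True] by simp
  next
    case False
    have "w n \<le> w 0 / v k N * v k N"
      using antimonoD[OF rapid_weight_antimono[OF w], of 0 n] v_pos[of k N] by simp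
    also have "\<dots> \<le> a * v k n"
      using antimonoD[OF antimono_v, of n N k] False v_pos[of k N]
      by (intro mult_mono) (auto simp: a_def)
    finally show ?thesis .
  qed
  then show ?thesis by (intro exI[of _ a]) (auto simp: a_def)
qed

section \<open>The topology defined by the rapid weights\<close>

definition wball :: "(nat \<Rightarrow> real) \<Rightarrow> cseq set" where
  "wball w = {x \<in> E. \<forall>n. w n * cmod (x n) \<le> 1}"

text \<open>Unit balls suffice as basic neighbourhoods because multiples of rapid weights are rapid; the
  maximum of two rapid weights takes care of intersections.\<close>

definition weighted_open :: "cseq set \<Rightarrow> bool" where
  "weighted_open U \<longleftrightarrow> U \<subseteq> E \<and> (\<forall>x\<in>U. \<exists>w. rapid w \<and> (\<forall>y\<in>E. y - x \<in> wball w \<longrightarrow> y \<in> U))"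

text \<open>The open unit ball of the weighted supremum norm. The uniform gap \<open>r < 1\<close> leaves room for a
  perturbation, which makes the set open.\<close>

definition wball_interior :: "(nat \<Rightarrow> real) \<Rightarrow> cseq set" where
  "wball_interior w = {x \<in> E. \<exists>r<1. \<forall>n. w n * cmod (x n) \<le> r}"

lemma is_ind_topology_X: "is_ind_topology v X"
  by (rule is_ind_topology_E_topology[OF alpha_pos s_gt_1 strict_mono_s])

lemma topspace_X: "topspace X = E"
  by (rule topspace_E_topology[OF alpha_pos s_gt_1 strict_mono_s])

lemma lc_hausdorff_X: "lc_hausdorff X"
  using is_ind_topology_X by (simp add: is_ind_topology_def ind_admissible_def)

lemma subspace_E: "cseq.subspace E"
  using lc_hausdorff_X by (simp add: lc_hausdorff_def topspace_X)

lemma E_0: "0 \<in> E" and E_add: "x \<in> E \<Longrightarrow> y \<in> E \<Longrightarrow> x + y \<in> E"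
  and E_scale: "x \<in> E \<Longrightarrow> cscale c x \<in> E"
  using subspace_E by (auto simp: cseq.subspace_def)

lemma E_diff: "x \<in> E \<Longrightarrow> y \<in> E \<Longrightarrow> x - y \<in> E"
  by (rule cseq.subspace_diff[OF subspace_E])

lemma wball_subset_E: "wball w \<subseteq> E"
  by (auto simp: wball_def)

lemma wball_interior_subset: "wball_interior w \<subseteq> wball w"
  by (auto simp: wball_def wball_interior_def intro: order_trans less_imp_le)

lemma wball_max:
  assumes w: "rapid w" "rapid w'" and x: "x \<in> wball (\<lambda>n. max (w n) (w' n))"
  shows "x \<in> wball w" "x \<in> wball w'"
proof -
  have "w n * cmod (x n) \<le> 1 \<and> w' n * cmod (x n) \<le> 1" for n
  proof -
    have "w n * cmod (x n) \<le> max (w n) (w' n) * cmod (x n)"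
      "w' n * cmod (x n) \<le> max (w n) (w' n) * cmod (x n)"
      by (auto intro: mult_right_mono)
    with x show ?thesis by (auto simp: wball_def dest!: spec[of _ n])
  qed
  then show "x \<in> wball w" "x \<in> wball w'" using x by (auto simp: wball_def)
qed

lemma istopology_weighted_open: "istopology weighted_open"
  unfolding istopology_def
proof (intro conjI allI impI)
  fix S T assume S: "weighted_open S" and T: "weighted_open T"
  show "weighted_open (S \<inter> T)"
    unfolding weighted_open_def
  proof (intro conjI ballI)
    show "S \<inter> T \<subseteq> E" using S by (auto simp: weighted_open_def)
    fix x assume x: "x \<in> S \<inter> T"
    obtain w where w: "rapid w" "\<forall>y\<in>E. y - x \<in> wball w \<longrightarrow> y \<in> S"
      using S x unfolding weighted_open_def by blast
    obtain w' where w': "rapid w'" "\<forall>y\<in>E. y - x \<in> wball w' \<longrightarrow> y \<in> T"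
      using T x unfolding weighted_open_def by blast
    show "\<exists>w. rapid w \<and> (\<forall>y\<in>E. y - x \<in> wball w \<longrightarrow> y \<in> S \<inter> T)"
      using rapid_weight_max[OF w(1) w'(1)] wball_max[OF w(1) w'(1)] w(2) w'(2) by blast
  qed
next
  fix K assume "\<forall>U\<in>K. weighted_open U"
  then show "weighted_open (\<Union>K)"
    unfolding weighted_open_def by (meson Union_iff Union_least)
qed

definition weighted_topology :: "cseq topology" where
  "weighted_topology = topology weighted_open"

lemma openin_weighted_topology: "openin weighted_topology U \<longleftrightarrow> weighted_open U"
  unfolding weighted_topology_def using istopology_weighted_open by simp

lemma ex_rapid: "\<exists>w. rapid w"
  using rapid_Min[of "\<lambda>_. 1"] by auto

lemma topspace_weighted_topology: "topspace weighted_topology = E"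
proof -
  have "weighted_open E"
    using ex_rapid by (auto simp: weighted_open_def)
  then show ?thesis
    unfolding topspace_def openin_weighted_topology weighted_open_def by blast
qed

text \<open>If the distance of \<open>x\<close> from \<open>a\<close> is at most \<open>r\<close>, the ball around \<open>x\<close> of radius \<open>(1 - r) / 2\<close>
  stays within distance \<open>(1 + r) / 2\<close>. Radii are expressed by rescaling the weight.\<close>

lemma weighted_open_translate_interior:
  assumes w: "rapid w" and a: "a \<in> E"
  shows "weighted_open {x \<in> E. x - a \<in> wball_interior w}"
  unfolding weighted_open_def
proof (intro conjI ballI)
  fix x assume "x \<in> {x \<in> E. x - a \<in> wball_interior w}"
  then obtain r where x: "x \<in> E" "r < 1" "\<And>n. w n * cmod (x n - a n) \<le> r"
    by (auto simp: wball_interior_def)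
  define w' where "w' = (\<lambda>n. 2 / (1 - r) * w n)"
  have "rapid w'"
    unfolding w'_def using x by (intro rapid_scale w) auto
  moreover have "y - a \<in> wball_interior w" if y: "y \<in> E" "y - x \<in> wball w'" for y
  proof -
    have "w n * cmod (y n - a n) \<le> (1 + r) / 2" for n
    proof -
      have "w' n * cmod (y n - x n) \<le> 1" using y by (simp add: wball_def)
      then have 1: "w n * cmod (y n - x n) \<le> (1 - r) / 2"
        using x by (simp add: w'_def field_simps)
      have "w n * cmod (y n - a n) \<le> w n * (cmod (y n - x n) + cmod (x n - a n))"
        using rapid_weight_pos[OF w, of n] norm_triangle_ineq[of "y n - x n" "x n - a n"]
        by (intro mult_left_mono) auto
      then show ?thesis using 1 x(3)[of n] by (simp add: distrib_left field_simps)
    qed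
    then show ?thesis
      using x(2) y a E_diff unfolding wball_interior_def by (auto intro!: exI[of _ "(1 + r) / 2"])
  qed
  ultimately show "\<exists>w'. rapid w' \<and> (\<forall>y\<in>E. y - x \<in> wball w' \<longrightarrow> y \<in> {x \<in> E. x - a \<in> wball_interior w})"
    by blast
qed auto

lemma zero_in_wball_interior: "0 \<in> wball_interior w"
  by (auto simp: wball_interior_def E_0 intro: exI[of _ 0])

lemma zero_nbhd_wball_interior:
  assumes "rapid w"
  shows "zero_nbhd weighted_topology (wball_interior w)"
proof -
  have "{x \<in> E. x - 0 \<in> wball_interior w} = wball_interior w"
    by (auto simp: wball_interior_def)
  then show ?thesis
    using weighted_open_translate_interior[OF assms E_0]
    by (simp add: zero_nbhd_def openin_weighted_topology zero_in_wball_interior)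
qed

lemma cseq_convex_wball_interior:
  assumes w: "rapid w"
  shows "cseq_convex (wball_interior w)"
  unfolding cseq_convex_def
proof (intro ballI)
  fix x y t assume x: "x \<in> wball_interior w" and y: "y \<in> wball_interior w" and t: "t \<in> {0..1::real}"
  obtain r where r: "r < 1" "\<And>n. w n * cmod (x n) \<le> r" using x by (auto simp: wball_interior_def)
  obtain q where q: "q < 1" "\<And>n. w n * cmod (y n) \<le> q" using y by (auto simp: wball_interior_def)
  let ?z = "cscale (of_real (1 - t)) x + cscale (of_real t) y"
  have "w n * cmod (?z n) \<le> max r q" for n
  proof -
    have "cmod (?z n) \<le> (1 - t) * cmod (x n) + t * cmod (y n)"
      using norm_triangle_ineq[of "of_real (1 - t) * x n" "of_real t * y n"] t
      by (simp add: cscale_def norm_mult del: of_real_diff)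
    then have "w n * cmod (?z n) \<le> w n * ((1 - t) * cmod (x n) + t * cmod (y n))"
      using rapid_weight_pos[OF w, of n] by (intro mult_left_mono) auto
    also have "\<dots> = (1 - t) * (w n * cmod (x n)) + t * (w n * cmod (y n))"
      by (simp add: algebra_simps)
    also have "\<dots> \<le> max r q"
      using t r(2)[of n] q(2)[of n] by (intro convex_bound_le) auto
    finally show ?thesis .
  qed
  moreover have "?z \<in> E"
    using x y by (intro E_add E_scale) (auto simp: wball_interior_def)
  ultimately show "?z \<in> wball_interior w"
    using r(1) q(1) unfolding wball_interior_def by (auto intro!: exI[of _ "max r q"])
qed

lemma Hausdorff_weighted_topology: "Hausdorff_space weighted_topology"
  unfolding Hausdorff_space_def topspace_weighted_topology openin_weighted_topology
proof (intro allI impI)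
  fix x y assume xy: "x \<in> E \<and> y \<in> E \<and> x \<noteq> y"
  then obtain n where n: "x n \<noteq> y n" by (auto simp: fun_eq_iff)
  obtain w where w: "rapid w" using ex_rapid by blast
  have wn: "0 < w n" by (rule rapid_weight_pos[OF w])
  define w' where "w' = (\<lambda>i. 2 / (w n * cmod (x n - y n)) * w i)"
  have w': "rapid w'"
    unfolding w'_def using n wn by (intro rapid_scale w) auto
  let ?U = "\<lambda>a. {z \<in> E. z - a \<in> wball_interior w'}"
  have "disjnt (?U x) (?U y)"
    unfolding disjnt_iff
  proof (intro allI notI)
    fix z assume "z \<in> ?U x \<and> z \<in> ?U y"
    then obtain r q where "r < 1" "q < 1" "w' n * cmod (z n - x n) \<le> r" "w' n * cmod (z n - y n) \<le> q"
      by (auto simp: wball_interior_def)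
    moreover have "w' n * cmod (x n - y n) \<le> w' n * (cmod (z n - x n) + cmod (z n - y n))"
      using rapid_weight_pos[OF w', of n] norm_triangle_ineq[of "x n - z n" "z n - y n"]
      by (intro mult_left_mono) (auto simp: norm_minus_commute)
    moreover have "w' n * cmod (x n - y n) = 2"
      using n wn by (simp add: w'_def)
    ultimately show False by (simp add: distrib_left)
  qed
  then show "\<exists>U V. weighted_open U \<and> weighted_open V \<and> x \<in> U \<and> y \<in> V \<and> disjnt U V"
    using weighted_open_translate_interior[OF w'] xy zero_in_wball_interior
    by (intro exI[of _ "?U x"] exI[of _ "?U y"]) auto
qed

lemma continuous_map_weighted_add:
  "continuous_map (prod_topology weighted_topology weighted_topology) weighted_topology (\<lambda>(x, y). x + y)"
  unfolding continuous_map_def topspace_prod_topology topspace_weighted_topology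
proof (intro conjI allI impI)
  show "(\<lambda>(x, y). x + y) \<in> E \<times> E \<rightarrow> E" using E_add by auto
  fix U assume "openin weighted_topology U"
  then have U: "weighted_open U" by (simp add: openin_weighted_topology)
  show "openin (prod_topology weighted_topology weighted_topology) {p \<in> E \<times> E. (case p of (x, y) \<Rightarrow> x + y) \<in> U}"
    unfolding openin_prod_topology_alt
  proof (intro allI impI)
    fix x y assume "(x, y) \<in> {p \<in> E \<times> E. (case p of (x, y) \<Rightarrow> x + y) \<in> U}"
    then have xy: "x \<in> E" "y \<in> E" "x + y \<in> U" by auto
    obtain w where w: "rapid w" "\<And>z. z \<in> E \<Longrightarrow> z - (x + y) \<in> wball w \<Longrightarrow> z \<in> U"
      using U xy unfolding weighted_open_def by blast
    define w' where "w' = (\<lambda>n. 2 * w n)"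
    have w': "rapid w'" unfolding w'_def by (intro rapid_scale w) auto
    let ?U = "\<lambda>a. {z \<in> E. z - a \<in> wball_interior w'}"
    have "x' + y' \<in> U" if "x' \<in> ?U x" "y' \<in> ?U y" for x' y'
    proof (rule w(2))
      have E: "x' \<in> E" "y' \<in> E" using that by auto
      have "w n * cmod ((x' + y' - (x + y)) n) \<le> 1" for n
      proof -
        have "w' n * cmod (x' n - x n) \<le> 1" "w' n * cmod (y' n - y n) \<le> 1"
          using that wball_interior_subset[of w'] by (auto simp: wball_def)
        moreover have "w n * cmod ((x' n - x n) + (y' n - y n)) \<le> w n * (cmod (x' n - x n) + cmod (y' n - y n))"
          using rapid_weight_pos[OF w(1), of n] by (intro mult_left_mono norm_triangle_ineq) auto
        ultimately show ?thesis by (simp add: w'_def distrib_left algebra_simps)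
      qed
      then show "x' + y' - (x + y) \<in> wball w"
        using E xy by (auto simp: wball_def intro!: E_diff E_add)
      show "x' + y' \<in> E" using E by (rule E_add)
    qed
    then show "\<exists>V W. openin weighted_topology V \<and> openin weighted_topology W \<and> x \<in> V \<and> y \<in> W \<and>
        V \<times> W \<subseteq> {p \<in> E \<times> E. (case p of (x, y) \<Rightarrow> x + y) \<in> U}"
      using weighted_open_translate_interior[OF w'] xy zero_in_wball_interior
      by (intro exI[of _ "?U x"] exI[of _ "?U y"]) (auto simp: openin_weighted_topology)
  qed
qed

text \<open>The usual splitting \<open>c' * x' - c * x = c' * (x' - x) + (c' - c) * x\<close>, in which the second
  term is controlled by the finite weighted supremum \<open>M\<close> of \<open>x\<close>.\<close>

lemma continuous_map_weighted_scale:
  "continuous_map (prod_topology euclidean weighted_topology) weighted_topology (\<lambda>(c, x). cscale c x)"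
  unfolding continuous_map_def topspace_prod_topology topspace_weighted_topology
proof (intro conjI allI impI)
  show "(\<lambda>(c, x). cscale c x) \<in> topspace euclidean \<times> E \<rightarrow> E" using E_scale by auto
  fix U assume "openin weighted_topology U"
  then have U: "weighted_open U" by (simp add: openin_weighted_topology)
  show "openin (prod_topology euclidean weighted_topology)
      {p \<in> topspace euclidean \<times> E. (case p of (c, x) \<Rightarrow> cscale c x) \<in> U}"
    unfolding openin_prod_topology_alt
  proof (intro allI impI)
    fix c :: complex and x assume "(c, x) \<in> {p \<in> topspace euclidean \<times> E. (case p of (c, x) \<Rightarrow> cscale c x) \<in> U}"
    then have x: "x \<in> E" "cscale c x \<in> U" by auto
    obtain w where w: "rapid w" "\<And>z. z \<in> E \<Longrightarrow> z - cscale c x \<in> wball w \<Longrightarrow> z \<in> U"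
      using U x unfolding weighted_open_def by blast
    obtain M where M: "M > 0" "\<And>n. w n * cmod (x n) \<le> M"
      using c0_norm_upper[of x w] rapid_E_subset_c0[OF w(1)] x
      by (metis gt_ex less_le_trans less_imp_le max.cobounded1 max.cobounded2 order_trans subsetD)
    define \<delta> where "\<delta> = min 1 (1 / (2 * M))"
    have \<delta>: "0 < \<delta>" "\<delta> \<le> 1" "\<delta> * M \<le> 1 / 2"
      using M(1) by (auto simp: \<delta>_def min_def field_simps)
    define w' where "w' = (\<lambda>n. (2 * (cmod c + 1)) * w n)"
    have w': "rapid w'" unfolding w'_def by (intro rapid_scale w) (simp add: add_nonneg_pos)
    let ?U = "{z \<in> E. z - x \<in> wball_interior w'}"
    have "cscale c' x' \<in> U" if c': "c' \<in> ball c \<delta>" and x': "x' \<in> ?U" for c' x'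
    proof (rule w(2))
      have E: "x' \<in> E" using x' by auto
      have "w n * cmod ((cscale c' x' - cscale c x) n) \<le> 1" for n
      proof -
        have wn: "0 < w n" by (rule rapid_weight_pos[OF w(1)])
        have d: "cmod (c' - c) \<le> \<delta>" using c' by (simp add: dist_norm norm_minus_commute)
        have c1: "cmod c' \<le> cmod c + 1"
          using d \<delta>(2) norm_triangle_ineq2[of c' c] by linarith
        have "w' n * cmod (x' n - x n) \<le> 1"
          using x' wball_interior_subset[of w'] by (auto simp: wball_def)
        then have 1: "(cmod c + 1) * (w n * cmod (x' n - x n)) \<le> 1 / 2"
          by (simp add: w'_def algebra_simps)
        have 2: "\<delta> * (w n * cmod (x n)) \<le> 1 / 2"
          using mult_left_mono[OF M(2)[of n], of \<delta>] \<delta> by linarith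
        have "(cscale c' x' - cscale c x) n = c' * (x' n - x n) + (c' - c) * x n"
          by (simp add: cscale_def algebra_simps)
        then have "cmod ((cscale c' x' - cscale c x) n) \<le> cmod c' * cmod (x' n - x n) + cmod (c' - c) * cmod (x n)"
          by (metis norm_mult norm_triangle_ineq)
        also have "\<dots> \<le> (cmod c + 1) * cmod (x' n - x n) + \<delta> * cmod (x n)"
          by (intro add_mono mult_right_mono c1 d) auto
        finally have "w n * cmod ((cscale c' x' - cscale c x) n)
            \<le> w n * ((cmod c + 1) * cmod (x' n - x n) + \<delta> * cmod (x n))"
          using wn by (intro mult_left_mono) auto
        also have "\<dots> = (cmod c + 1) * (w n * cmod (x' n - x n)) + \<delta> * (w n * cmod (x n))"
          by (simp add: algebra_simps)
        finally show ?thesis using 1 2 by linarith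
      qed
      then show "cscale c' x' - cscale c x \<in> wball w"
        using E x by (auto simp: wball_def intro!: E_diff E_scale)
      show "cscale c' x' \<in> E" using E by (rule E_scale)
    qed
    then show "\<exists>V W. openin euclidean V \<and> openin weighted_topology W \<and> c \<in> V \<and> x \<in> W \<and>
        V \<times> W \<subseteq> {p \<in> topspace euclidean \<times> E. (case p of (c, x) \<Rightarrow> cscale c x) \<in> U}"
      using weighted_open_translate_interior[OF w'] x zero_in_wball_interior \<delta>(1)
      by (intro exI[of _ "ball c \<delta>"] exI[of _ ?U]) (auto simp: openin_weighted_topology)
  qed
qed

lemma lc_hausdorff_weighted_topology: "lc_hausdorff weighted_topology"
  unfolding lc_hausdorff_def
proof (intro conjI allI impI)
  show "cseq.subspace (topspace weighted_topology)"
    by (simp add: topspace_weighted_topology subspace_E)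
  fix U assume U: "zero_nbhd weighted_topology U"
  then obtain w where w: "rapid w" "\<And>y. y \<in> E \<Longrightarrow> y - 0 \<in> wball w \<Longrightarrow> y \<in> U"
    unfolding zero_nbhd_def openin_weighted_topology weighted_open_def by blast
  have "wball_interior w \<subseteq> U"
    using w(2) wball_interior_subset[of w] wball_subset_E[of w] by auto
  then show "\<exists>V. zero_nbhd weighted_topology V \<and> cseq_convex V \<and> V \<subseteq> U"
    using zero_nbhd_wball_interior[OF w(1)] cseq_convex_wball_interior[OF w(1)] by blast
qed (fact continuous_map_weighted_add continuous_map_weighted_scale Hausdorff_weighted_topology)+

text \<open>A rapid weight is dominated by a multiple of \<open>v k\<close>, so its ball contains a ball of the norm of
  the \<open>k\<close>-th step. By the maximality of the inductive limit topology, this is one half of the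
  comparison of the two topologies.\<close>

lemma ind_admissible_weighted_topology: "ind_admissible v weighted_topology"
  unfolding ind_admissible_def
proof (intro conjI allI lc_hausdorff_weighted_topology)
  show "topspace weighted_topology = (\<Union>k. c0 (v k))"
    by (simp add: topspace_weighted_topology E_space_def)
  fix k
  interpret Metric_space "c0 (v k)" "\<lambda>x y. \<bar>c0_norm (v k) (x - y)\<bar>"
    by (rule Metric_space_c0[OF v_pos])
  have sub: "c0 (v k) \<subseteq> E" by (auto simp: E_space_def)
  show "continuous_map (c0_topology (v k)) weighted_topology (\<lambda>x. x)"
    unfolding continuous_map_def topspace_c0_topology[OF v_pos] topspace_weighted_topology
      openin_weighted_topology
  proof (intro conjI allI impI)
    fix U assume U: "weighted_open U"
    show "openin (c0_topology (v k)) {x \<in> c0 (v k). x \<in> U}"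
      unfolding c0_topology_def openin_mtopology
    proof (intro conjI allI impI)
      fix x assume "x \<in> {x \<in> c0 (v k). x \<in> U}"
      then have x: "x \<in> c0 (v k)" "x \<in> U" by auto
      obtain w where w: "rapid w" "\<And>z. z \<in> E \<Longrightarrow> z - x \<in> wball w \<Longrightarrow> z \<in> U"
        using U x unfolding weighted_open_def by blast
      obtain a where a: "a > 0" "\<And>n. w n \<le> a * v k n"
        using rapid_le_v[OF w(1)] by blast
      have "mball x (1 / a) \<subseteq> {x \<in> c0 (v k). x \<in> U}"
      proof
        fix y assume "y \<in> mball x (1 / a)"
        then have y: "y \<in> c0 (v k)" "\<bar>c0_norm (v k) (x - y)\<bar> < 1 / a" by auto
        have "w n * cmod ((y - x) n) \<le> 1" for n
        proof -
          have "v k n * cmod ((x - y) n) \<le> 1 / a"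
            using c0_norm_upper[OF c0_diff[OF v_pos x(1) y(1)], of n] y(2) by linarith
          then have "a * v k n * cmod ((y - x) n) \<le> 1"
            using a(1) by (simp add: field_simps norm_minus_commute)
          then show ?thesis
            using mult_right_mono[OF a(2)[of n], of "cmod ((y - x) n)"] by simp
        qed
        then have "y - x \<in> wball w"
          using x y sub by (auto simp: wball_def intro: E_diff)
        then show "y \<in> {x \<in> c0 (v k). x \<in> U}" using w(2) y sub by auto
      qed
      then show "\<exists>r>0. mball x r \<subseteq> {x \<in> c0 (v k). x \<in> U}"
        using a(1) by (intro exI[of _ "1 / a"]) auto
    qed auto
  qed (use sub in auto)
qed

section \<open>Comparison with the inductive limit topology\<close>

lemma zero_nbhd_X_contains_c0_ball:
  assumes U: "zero_nbhd X U"
  shows "\<exists>\<epsilon>>0. \<forall>x\<in>c0 (v k). (\<forall>n. v k n * cmod (x n) \<le> \<epsilon>) \<longrightarrow> x \<in> U"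
proof -
  interpret Metric_space "c0 (v k)" "\<lambda>x y. \<bar>c0_norm (v k) (x - y)\<bar>"
    by (rule Metric_space_c0[OF v_pos])
  have "continuous_map (c0_topology (v k)) X (\<lambda>x. x)"
    using is_ind_topology_X by (simp add: is_ind_topology_def ind_admissible_def)
  then have "openin (c0_topology (v k)) {x \<in> c0 (v k). x \<in> U}"
    using U topspace_c0_topology[OF v_pos] unfolding continuous_map_def zero_nbhd_def by fastforce
  moreover have "0 \<in> {x \<in> c0 (v k). x \<in> U}"
    using U by (simp add: zero_nbhd_def zero_in_c0)
  ultimately obtain r where r: "r > 0" "mball 0 r \<subseteq> {x \<in> c0 (v k). x \<in> U}"
    unfolding c0_topology_def openin_mtopology by blast
  have "x \<in> U" if x: "x \<in> c0 (v k)" "\<forall>n. v k n * cmod (x n) \<le> r / 2" for x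
  proof -
    have "c0_norm (v k) (0 - x) \<le> r / 2"
      unfolding c0_norm_def using x by (intro cSUP_least) auto
    moreover have "0 \<le> c0_norm (v k) (0 - x)"
      using c0_norm_upper[OF c0_diff[OF v_pos zero_in_c0 x(1)], of 0] v_pos[of k 0]
      by (meson mult_nonneg_nonneg norm_ge_zero less_imp_le order_trans)
    ultimately have "x \<in> mball 0 r"
      using x r(1) by (simp add: zero_in_c0)
    then show ?thesis using r(2) by blast
  qed
  then show ?thesis using r(1) by (intro exI[of _ "r / 2"]) auto
qed

text \<open>Let a convex neighbourhood \<open>V\<close> contain the closed balls of radius \<open>\<epsilon> k\<close> of all steps, and let \<open>w\<close>
  at \<open>n\<close> be the minimum of \<open>2 ^ (k + 2) / \<epsilon> k * v k n\<close> over \<open>k \<le> n\<close>. Group the indices \<open>n\<close> by the index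
  \<open>\<kappa> n\<close> at which the minimum is attained. On the group of \<open>k\<close>, the bound \<open>w n * cmod (x n) \<le> 1\<close>
  says that \<open>2 ^ (k + 2)\<close> times the restriction of \<open>x\<close> lies in the ball of the \<open>k\<close>-th step. The
  groups are finite because \<open>v (Suc k)\<close> is negligible against \<open>v k\<close>, so these restrictions belong to
  every step. Finitely many groups form a dyadic convex combination of total mass below one half. The
  other half goes to twice the rest of \<open>x\<close>, which is supported far out and hence small in the step
  that contains \<open>x\<close>.\<close>

lemma zero_nbhd_X_contains_wball:
  assumes U: "zero_nbhd X U"
  shows "\<exists>w. rapid w \<and> wball w \<subseteq> U"
proof -
  obtain V where V: "zero_nbhd X V" "cseq_convex V" "V \<subseteq> U"
    using lc_hausdorff_X U unfolding lc_hausdorff_def by blast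
  obtain \<epsilon> where \<epsilon>: "\<And>k. 0 < \<epsilon> k"
    "\<And>k x. x \<in> c0 (v k) \<Longrightarrow> (\<And>n. v k n * cmod (x n) \<le> \<epsilon> k) \<Longrightarrow> x \<in> V"
    using zero_nbhd_X_contains_c0_ball[OF V(1)] by metis
  define a where "a k = 2 ^ (k + 2) / \<epsilon> k" for k
  have a: "0 < a k" for k using \<epsilon>(1) by (simp add: a_def)
  define w where "w n = Min ((\<lambda>k. a k * v k n) ` {..n})" for n
  have w: "rapid w" unfolding w_def by (rule rapid_Min[OF a])
  have "\<exists>k\<le>n. w n = a k * v k n" for n
  proof -
    have "w n \<in> (\<lambda>k. a k * v k n) ` {..n}" unfolding w_def by (rule Min_in) auto
    then show ?thesis by auto
  qed
  then obtain \<kappa> where \<kappa>: "\<And>n. \<kappa> n \<le> n" "\<And>n. w n = a (\<kappa> n) * v (\<kappa> n) n" by metis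
  \<comment> \<open>Finiteness of the groups: the candidate of index \<open>Suc k\<close> eventually beats the one of index \<open>k\<close>.\<close>
  have eventually_ne: "\<forall>\<^sub>F n in sequentially. \<kappa> n \<noteq> k" for k
  proof -
    have "\<forall>\<^sub>F n in sequentially. 2 * a (Suc k) / a k * v (Suc k) n \<le> v k n"
      unfolding v_weight_def using s_gt_1[of k] strict_monoD[OF strict_mono_s, of k "Suc k"]
      by (intro eventually_mult_powr_le) auto
    then show ?thesis using eventually_ge_at_top[of "Suc k"]
    proof eventually_elim
      case (elim n)
      have "w n \<le> a (Suc k) * v (Suc k) n"
        unfolding w_def using elim by (intro Min_le) auto
      moreover have "2 * (a (Suc k) * v (Suc k) n) \<le> a k * v k n"
        using elim a[of k] by (simp add: field_simps)
      moreover have "0 < a (Suc k) * v (Suc k) n" using a v_pos by simp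
      ultimately show ?case using \<kappa>(2)[of n] by auto
    qed
  qed
  have "x \<in> V" if x: "x \<in> wball w" for x
  proof -
    obtain m where m: "x \<in> c0 (v m)" using x by (auto simp: wball_def E_space_def)
    then have "\<forall>\<^sub>F n in sequentially. v m n * cmod (x n) < \<epsilon> m / 2"
      unfolding c0_def using \<epsilon>(1)[of m] by (auto dest!: order_tendstoD(2)[of _ _ _ "\<epsilon> m / 2"])
    then obtain N where N: "\<And>n. n \<ge> N \<Longrightarrow> v m n * cmod (x n) < \<epsilon> m / 2"
      by (auto simp: eventually_sequentially)
    \<comment> \<open>Since \<open>\<kappa> n \<le> n\<close>, the groups from \<open>N\<close> on contain only indices \<open>n \<ge> N\<close>.\<close>
    define y where "y k = (\<lambda>n. if \<kappa> n = k then 2 ^ (k + 2) * x n else 0)" for k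
    define z where "z = (\<lambda>n. if \<kappa> n \<ge> N then 2 * x n else 0)"
    have y: "y k \<in> V" for k
    proof (rule \<epsilon>(2)[of _ k])
      have "\<forall>\<^sub>F n in sequentially. v k n * cmod (y k n) = 0"
        using eventually_ne[of k] by eventually_elim (simp add: y_def)
      then show "y k \<in> c0 (v k)"
        unfolding c0_def by (auto intro: tendsto_eventually)
      fix n
      show "v k n * cmod (y k n) \<le> \<epsilon> k"
      proof (cases "\<kappa> n = k")
        case True
        have "w n * cmod (x n) \<le> 1" using x by (simp add: wball_def)
        then have "2 ^ (k + 2) / \<epsilon> k * v k n * cmod (x n) \<le> 1"
          using \<kappa>(2)[of n] True by (simp add: a_def)
        then show ?thesis
          using \<epsilon>(1)[of k] True by (simp add: y_def norm_mult norm_power field_simps)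
      qed (use \<epsilon>(1)[of k] in \<open>simp add: y_def\<close>)
    qed
    have z: "z \<in> V"
    proof (rule \<epsilon>(2)[of _ m])
      have "(\<lambda>n. 2 * (v m n * cmod (x n))) \<longlonglongrightarrow> 2 * 0"
        using m unfolding c0_def by (intro tendsto_mult) auto
      then have lim: "(\<lambda>n. 2 * (v m n * cmod (x n))) \<longlonglongrightarrow> 0" by simp
      have "(\<lambda>n. v m n * cmod (z n)) \<longlonglongrightarrow> 0"
        by (rule tendsto_sandwich[OF _ _ tendsto_const lim])
           (use v_pos in \<open>auto intro!: always_eventually simp: less_imp_le z_def norm_mult\<close>)
      then show "z \<in> c0 (v m)" by (simp add: c0_def)
      fix n
      show "v m n * cmod (z n) \<le> \<epsilon> m"
      proof (cases "\<kappa> n \<ge> N")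
        case True
        then have "n \<ge> N" using \<kappa>(1)[of n] by simp
        from N[OF this] show ?thesis using True by (simp add: z_def norm_mult)
      qed (use \<epsilon>(1)[of m] in \<open>simp add: z_def\<close>)
    qed
    let ?y = "\<Sum>k<N. cscale (1 / 2 ^ Suc k) (y k)"
    have "0 \<in> V" using V(1) by (simp add: zero_nbhd_def)
    then have "?y \<in> V" using y by (intro cseq_convex_dyadic_sum[OF V(2)])
    moreover have "1 / 2 \<in> {0..1::real}" by simp
    ultimately have "cscale (of_real (1 - 1 / 2)) ?y + cscale (of_real (1 / 2)) z \<in> V"
      using z V(2) unfolding cseq_convex_def by blast
    also have "cscale (of_real (1 - 1 / 2)) ?y + cscale (of_real (1 / 2)) z = x"
    proof
      fix n
      have "?y n = (\<Sum>k<N. if \<kappa> n = k then 2 * x n else 0)"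
        unfolding cseq_sum_apply by (intro sum.cong) (auto simp: cscale_def y_def)
      also have "\<dots> = (if \<kappa> n < N then 2 * x n else 0)" by simp
      finally show "(cscale (of_real (1 - 1 / 2)) ?y + cscale (of_real (1 / 2)) z) n = x n"
        by (simp add: cscale_def z_def)
    qed
    finally show ?thesis .
  qed
  then show ?thesis using w V(3) by blast
qed

lemma continuous_map_translation:
  assumes "x \<in> E"
  shows "continuous_map X X (\<lambda>y. x + y)"
proof -
  have "continuous_map X (prod_topology X X) (\<lambda>y. (x, y))"
    using assms by (intro continuous_map_pairedI) (auto simp: topspace_X)
  moreover have "continuous_map (prod_topology X X) X (\<lambda>(x, y). x + y)"
    using lc_hausdorff_X by (simp add: lc_hausdorff_def)
  ultimately show ?thesis
    using continuous_map_compose by (fastforce simp: o_def)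
qed

text \<open>Translations are continuous for the inductive limit topology, which reduces its open sets to
  neighbourhoods of zero.\<close>

theorem openin_X_iff: "openin X U \<longleftrightarrow> weighted_open U"
proof
  assume "weighted_open U"
  then show "openin X U"
    using is_ind_topology_X ind_admissible_weighted_topology
    unfolding is_ind_topology_def openin_weighted_topology[symmetric] by blast
next
  assume U: "openin X U"
  show "weighted_open U"
    unfolding weighted_open_def
  proof (intro conjI ballI)
    show UE: "U \<subseteq> E" using openin_subset[OF U] by (simp add: topspace_X)
    fix x assume x: "x \<in> U"
    then have xE: "x \<in> E" using UE by blast
    have "openin X {y \<in> topspace X. x + y \<in> U}"
      by (rule openin_continuous_map_preimage[OF continuous_map_translation[OF xE] U])
    then have "zero_nbhd X {y \<in> E. x + y \<in> U}"
      using x E_0 by (simp add: zero_nbhd_def topspace_X)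
    then obtain w where w: "rapid w" "wball w \<subseteq> {y \<in> E. x + y \<in> U}"
      using zero_nbhd_X_contains_wball by blast
    have "y \<in> U" if "y - x \<in> wball w" for y
    proof -
      have "x + (y - x) \<in> U" using that w(2) by blast
      then show ?thesis by simp
    qed
    then show "\<exists>w. rapid w \<and> (\<forall>y\<in>E. y - x \<in> wball w \<longrightarrow> y \<in> U)"
      using w(1) by blast
  qed
qed

end

section \<open>Power boundedness and mean ergodicity\<close>

definition first_coord_proj :: "cseq \<Rightarrow> cseq" where
  "first_coord_proj x = (\<lambda>_. x 0)"

context power_weights
begin

lemma zero_nbhd_X_wball_interior: "rapid w \<Longrightarrow> zero_nbhd X (wball_interior w)"
  using zero_nbhd_wball_interior
  by (simp add: zero_nbhd_def openin_X_iff openin_weighted_topology)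

lemma E_sum: "(\<And>i. i \<in> A \<Longrightarrow> f i \<in> E) \<Longrightarrow> (\<Sum>i\<in>A. f i) \<in> E"
  by (rule cseq.subspace_sum[OF subspace_E])

text \<open>By additivity, continuity at every point follows from the comparison of unit balls around
  zero.\<close>

lemma cont_opsI:
  assumes E: "\<And>x. x \<in> E \<Longrightarrow> T x \<in> E"
    and add: "\<And>x y. x \<in> E \<Longrightarrow> y \<in> E \<Longrightarrow> T (x + y) = T x + T y"
    and scale: "\<And>c x. x \<in> E \<Longrightarrow> T (cscale c x) = cscale c (T x)"
    and ball: "\<And>w. rapid w \<Longrightarrow> \<exists>w'. rapid w' \<and> T ` wball w' \<subseteq> wball w"
  shows "T \<in> cont_ops X"
proof -
  have "weighted_open {x \<in> E. T x \<in> U}" if U: "weighted_open U" for U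
    unfolding weighted_open_def
  proof (intro conjI ballI)
    fix x assume "x \<in> {x \<in> E. T x \<in> U}"
    then have x: "x \<in> E" "T x \<in> U" by auto
    obtain w where w: "rapid w" "\<And>z. z \<in> E \<Longrightarrow> z - T x \<in> wball w \<Longrightarrow> z \<in> U"
      using U x unfolding weighted_open_def by blast
    obtain w' where w': "rapid w'" "T ` wball w' \<subseteq> wball w" using ball[OF w(1)] by blast
    have "T y \<in> U" if y: "y \<in> E" "y - x \<in> wball w'" for y
    proof (rule w(2)[OF E[OF y(1)]])
      have "T y = T (y - x) + T x"
        using add[OF E_diff[OF y(1) x(1)] x(1)] by simp
      then have "T y - T x = T (y - x)" by simp
      then show "T y - T x \<in> wball w" using w'(2) y(2) by auto
    qed
    then show "\<exists>w. rapid w \<and> (\<forall>y\<in>E. y - x \<in> wball w \<longrightarrow> y \<in> {x \<in> E. T x \<in> U})"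
      using w'(1) by blast
  qed auto
  then have "continuous_map X X T"
    using E by (auto simp: continuous_map_def topspace_X openin_X_iff)
  then show ?thesis
    using add scale by (simp add: cont_ops_def topspace_X)
qed

text \<open>The weights \<open>t powr (- \<alpha> n)\<close> decrease with \<open>n\<close>, so averaging preserves each growth bound.\<close>

lemma cesaro_E: assumes "x \<in> E" shows "cesaro x \<in> E"
proof -
  obtain t M where t: "t > 1" and M: "\<And>n. t powr (- \<alpha> n) * cmod (x n) \<le> M"
    using assms unfolding E_iff by blast
  have "antimono (\<lambda>n. t powr (- \<alpha> n))"
    using t strict_mono_leD[OF strict_mono_alpha] by (intro antimonoI) (simp add: powr_mono)
  then have "t powr (- \<alpha> n) * cmod (cesaro x n) \<le> M" for n
    using t by (intro weighted_cesaro_le[where w = "\<lambda>n. t powr (- \<alpha> n)"] M) auto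
  then show ?thesis using t unfolding E_iff by blast
qed

lemma cesaro_wball:
  assumes "rapid w" "x \<in> wball w"
  shows "cesaro x \<in> wball w"
  using assms weighted_cesaro_le[of w x 1] rapid_weight_antimono[of \<alpha> w] rapid_weight_pos[of \<alpha> w]
  by (auto simp: wball_def cesaro_E)

lemma cesaro_pow_E: "x \<in> E \<Longrightarrow> (cesaro ^^ m) x \<in> E"
  by (induction m) (auto intro: cesaro_E)

lemma cesaro_pow_wball: "rapid w \<Longrightarrow> x \<in> wball w \<Longrightarrow> (cesaro ^^ m) x \<in> wball w"
  by (induction m) (auto intro: cesaro_wball)

lemma cesaro_pow_add: "(cesaro ^^ m) (x + y) = (cesaro ^^ m) x + (cesaro ^^ m) y"
proof (induction m)
  case (Suc m)
  show ?case unfolding funpow.simps o_apply Suc cesaro_add ..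
qed simp

lemma cesaro_pow_scale: "(cesaro ^^ m) (cscale c x) = cscale c ((cesaro ^^ m) x)"
  by (induction m) (auto simp: cesaro_scale)

lemma cesaro_pow_cont_ops: "cesaro ^^ m \<in> cont_ops X"
proof (rule cont_opsI)
  show "\<exists>w'. rapid w' \<and> (cesaro ^^ m) ` wball w' \<subseteq> wball w" if "rapid w" for w
    using that cesaro_pow_wball by blast
qed (auto simp: cesaro_pow_E cesaro_pow_add cesaro_pow_scale)

lemma cesaro_cont_ops: "cesaro \<in> cont_ops X"
  using cesaro_pow_cont_ops[of 1] by simp

lemma power_bounded_cesaro: "power_bounded X cesaro"
  unfolding power_bounded_def equicontinuous_ops_def
proof (intro conjI allI impI)
  show "{cesaro ^^ n | n. 1 \<le> n} \<subseteq> cont_ops X"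
    using cesaro_pow_cont_ops by blast
  fix V assume "zero_nbhd X V"
  then obtain w where w: "rapid w" "wball w \<subseteq> V" using zero_nbhd_X_contains_wball by blast
  then show "\<exists>U. zero_nbhd X U \<and> (\<forall>T\<in>{cesaro ^^ n | n. 1 \<le> n}. T ` U \<subseteq> V)"
    using zero_nbhd_X_wball_interior cesaro_pow_wball wball_interior_subset[of w]
    by (intro exI[of _ "wball_interior w"]) blast
qed (rule cesaro_cont_ops)

lemma ergodic_mean_cont_ops: "ergodic_mean cesaro n \<in> cont_ops X"
proof (rule cont_opsI)
  fix w assume w: "rapid w"
  have "ergodic_mean cesaro n x \<in> wball w" if x: "x \<in> wball w" for x
  proof -
    have "w j * cmod (ergodic_mean cesaro n x j) \<le> 1" for j
    proof -
      have wj: "0 < w j" by (rule rapid_weight_pos[OF w])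
      have "cmod (\<Sum>m=1..n. (cesaro ^^ m) x j) \<le> (\<Sum>m=1..n. 1 / w j)"
      proof (rule sum_norm_le)
        fix m
        have "w j * cmod ((cesaro ^^ m) x j) \<le> 1"
          using cesaro_pow_wball[OF w x, of m] by (simp add: wball_def)
        then show "cmod ((cesaro ^^ m) x j) \<le> 1 / w j" using wj by (simp add: field_simps)
      qed
      then have "cmod (ergodic_mean cesaro n x j) \<le> 1 / w j"
        using wj by (cases "n = 0")
          (auto simp: ergodic_mean_def cscale_def cseq_sum_apply norm_divide field_simps)
      then show ?thesis using wj by (simp add: field_simps)
    qed
    moreover have "ergodic_mean cesaro n x \<in> E"
      using x wball_subset_E unfolding ergodic_mean_def by (intro E_scale E_sum cesaro_pow_E) blast
    ultimately show ?thesis by (simp add: wball_def)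
  qed
  then show "\<exists>w'. rapid w' \<and> ergodic_mean cesaro n ` wball w' \<subseteq> wball w"
    using w by blast
next
  show "ergodic_mean cesaro n x \<in> E" if "x \<in> E" for x
    using that unfolding ergodic_mean_def by (intro E_scale E_sum cesaro_pow_E)
  show "ergodic_mean cesaro n (x + y) = ergodic_mean cesaro n x + ergodic_mean cesaro n y" for x y
    by (simp add: ergodic_mean_def cesaro_pow_add sum.distrib cseq.scale_right_distrib)
  show "ergodic_mean cesaro n (cscale c x) = cscale c (ergodic_mean cesaro n x)" for c x
    by (simp add: ergodic_mean_def cesaro_pow_scale cseq.scale_sum_right mult.commute)
qed

lemma first_coord_proj_E: "first_coord_proj x \<in> E"
  by (rule bounded_in_E[of _ "cmod (x 0)"]) (simp add: first_coord_proj_def)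

text \<open>The ball condition at the index \<open>0\<close>, where a decreasing weight is largest, controls the whole
  constant sequence.\<close>

lemma first_coord_proj_wball:
  assumes w: "rapid w" and x: "x \<in> wball w"
  shows "first_coord_proj x \<in> wball w"
proof -
  have "w n * cmod (x 0) \<le> 1" for n
  proof -
    have "w n * cmod (x 0) \<le> w 0 * cmod (x 0)"
      using antimonoD[OF rapid_weight_antimono[OF w], of 0 n] by (intro mult_right_mono) auto
    also have "\<dots> \<le> 1" using x by (simp add: wball_def)
    finally show ?thesis .
  qed
  then show ?thesis using first_coord_proj_E by (simp add: wball_def first_coord_proj_def)
qed

lemma first_coord_proj_cont_ops: "first_coord_proj \<in> cont_ops X"
proof (rule cont_opsI)
  show "\<exists>w'. rapid w' \<and> first_coord_proj ` wball w' \<subseteq> wball w" if "rapid w" for w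
    using that first_coord_proj_wball by blast
qed (auto simp: first_coord_proj_E, auto simp: first_coord_proj_def cscale_def)

lemma diff_first_coord_proj_cont_ops: "(\<lambda>x. x - first_coord_proj x) \<in> cont_ops X"
proof (rule cont_opsI)
  fix w assume w: "rapid w"
  define w' where "w' = (\<lambda>n. 2 * w n)"
  have w': "rapid w'" unfolding w'_def by (intro rapid_scale w) simp
  have "x - first_coord_proj x \<in> wball w" if x: "x \<in> wball w'" for x
  proof -
    have "w n * cmod (x n - first_coord_proj x n) \<le> 1" for n
    proof -
      have "w' n * cmod (x n) \<le> 1" "w' n * cmod (first_coord_proj x n) \<le> 1"
        using x first_coord_proj_wball[OF w' x] by (auto simp: wball_def)
      moreover have "w n * cmod (x n - first_coord_proj x n) \<le> w n * (cmod (x n) + cmod (first_coord_proj x n))"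
        using rapid_weight_pos[OF w, of n] by (intro mult_left_mono norm_triangle_ineq4) auto
      ultimately show ?thesis by (simp add: w'_def distrib_left)
    qed
    then show ?thesis
      using x first_coord_proj_E E_diff by (simp add: wball_def)
  qed
  then show "\<exists>w'. rapid w' \<and> (\<lambda>x. x - first_coord_proj x) ` wball w' \<subseteq> wball w"
    using w' by blast
qed (auto simp: E_diff first_coord_proj_E, auto simp: first_coord_proj_def cscale_def fun_eq_iff algebra_simps)

lemma bounded_in_X_weighted:
  assumes B: "bounded_in X B" and w: "rapid w"
  shows "\<exists>r>0. \<forall>x\<in>B. \<forall>n. w n * cmod (x n) \<le> r"
proof -
  obtain r where r: "r > 0" "B \<subseteq> cscale (of_real r) ` wball_interior w"
    using B zero_nbhd_X_wball_interior[OF w] unfolding bounded_in_def by blast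
  have "w n * cmod (x n) \<le> r" if x: "x \<in> B" for x n
  proof -
    obtain y where y: "y \<in> wball w" "x = cscale (of_real r) y"
      using r(2) x wball_interior_subset[of w] by blast
    have "r * (w n * cmod (y n)) \<le> r * 1"
      using r(1) y(1) by (intro mult_left_mono) (auto simp: wball_def)
    then show ?thesis using r(1) y(2) by (simp add: cscale_def norm_mult mult_ac)
  qed
  then show ?thesis using r(1) by blast
qed

text \<open>The factor \<open>w j\<close> is split as \<open>sqrt (w j) * sqrt (w j)\<close>: one factor is spent on the uniform bound
  for the entries of \<open>x\<close> up to \<open>j\<close>, which leaves \<open>sqrt (w j) * min 1 (j / n) * (2 * r)\<close>.\<close>

lemma ergodic_mean_uniform_on_bounded:
  assumes B: "bounded_in X B" and w: "rapid w"
  shows "\<forall>\<^sub>F n in sequentially. \<forall>x\<in>B. ergodic_mean cesaro n x - first_coord_proj x \<in> wball w"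
proof -
  have BE: "B \<subseteq> E" using B by (simp add: bounded_in_def topspace_X)
  have sq: "rapid (\<lambda>n. sqrt (w n))" by (rule rapid_weight_sqrt[OF w])
  have wpos: "0 < w n" for n by (rule rapid_weight_pos[OF w])
  obtain r where r: "r > 0" "\<And>x n. x \<in> B \<Longrightarrow> sqrt (w n) * cmod (x n) \<le> r"
    using bounded_in_X_weighted[OF B sq] by blast
  \<comment> \<open>Rapid decay for the base \<open>1\<close>, applied to a multiple of \<open>w\<close>, says that \<open>w\<close> tends to zero.\<close>
  have "\<forall>\<^sub>F j in sequentially. sqrt (w j) \<le> 1 / (2 * r)"
  proof -
    have "\<forall>\<^sub>F j in sequentially. (2 * r) * w j * (2 * r) \<le> 1 powr (- \<alpha> j)"
      using rapid_weight_eventually[OF rapid_scale[OF w, of "(2 * r) * (2 * r)"], of 1] r(1)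
      by (simp add: mult_ac)
    then show ?thesis
    proof eventually_elim
      case (elim j)
      have "w j \<le> (1 / (2 * r))\<^sup>2"
        using elim r(1) by (simp add: power2_eq_square field_simps)
      then show ?case using r(1) by (intro real_le_lsqrt) auto
    qed
  qed
  then obtain J where J: "\<And>j. j \<ge> J \<Longrightarrow> sqrt (w j) \<le> 1 / (2 * r)"
    by (auto simp: eventually_sequentially)
  \<comment> \<open>From \<open>N\<close> on, \<open>J / n\<close> makes up for the largest weight at the indices below \<open>J\<close>.\<close>
  obtain N where N: "real N \<ge> sqrt (w 0) * real J * (2 * r)" using real_arch_simple by blast
  have "ergodic_mean cesaro n x - first_coord_proj x \<in> wball w" if n: "n \<ge> max 1 N" and x: "x \<in> B" for n x
  proof -
    have "w j * cmod (ergodic_mean cesaro n x j - x 0) \<le> 1" for j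
    proof -
      have wj: "0 < sqrt (w j)" using wpos by simp
      have dec: "sqrt (w j) \<le> sqrt (w i)" if "i \<le> j" for i
        using antimonoD[OF rapid_weight_antimono[OF w] that] by simp
      have bd: "cmod (x i) \<le> r / sqrt (w j)" if "i \<le> j" for i
      proof -
        have "sqrt (w j) * cmod (x i) \<le> r"
          using mult_right_mono[OF dec[OF that], of "cmod (x i)"] r(2)[OF x, of i] by simp
        then show ?thesis using wj by (simp add: pos_le_divide_eq mult.commute)
      qed
      have "cmod (x i - x 0) \<le> 2 * r / sqrt (w j)" if "i \<le> j" for i
        using norm_triangle_ineq4[of "x i" "x 0"] bd[OF that] bd[of 0] by simp
      then have "cmod (ergodic_mean cesaro n x j - x 0) \<le> min 1 (real j / real n) * (2 * r / sqrt (w j))"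
        using n by (intro norm_ergodic_mean_diff_le) auto
      then have "w j * cmod (ergodic_mean cesaro n x j - x 0)
          \<le> w j * (min 1 (real j / real n) * (2 * r / sqrt (w j)))"
        using wpos[of j] by (intro mult_left_mono) auto
      also have "\<dots> = sqrt (w j) * min 1 (real j / real n) * (2 * r)"
        using real_div_sqrt[of "w j"] wpos[of j] by (simp add: field_simps)
      also have "\<dots> \<le> 1"
      proof (cases "j \<ge> J")
        case True
        have "sqrt (w j) * min 1 (real j / real n) \<le> 1 / (2 * r) * 1"
          using J[OF True] r(1) by (intro mult_mono) auto
        then show ?thesis using r(1) by (simp add: field_simps)
      next
        case False
        have "sqrt (w j) * min 1 (real j / real n) \<le> sqrt (w 0) * (real J / real n)"
        proof (rule mult_mono)
          have "real j / real n \<le> real J / real n" using False by (intro divide_right_mono) auto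
          then show "min 1 (real j / real n) \<le> real J / real n" by simp
        qed (use dec[of 0] wpos[of 0] in auto)
        then have "sqrt (w j) * min 1 (real j / real n) * (2 * r) \<le> sqrt (w 0) * (real J / real n) * (2 * r)"
          using r(1) by (intro mult_right_mono) auto
        also have "\<dots> = sqrt (w 0) * real J * (2 * r) / real n" by simp
        also have "\<dots> \<le> 1" using N n by (simp add: divide_le_eq_1)
        finally show ?thesis .
      qed
      finally show ?thesis .
    qed
    moreover have "ergodic_mean cesaro n x - first_coord_proj x \<in> E"
      using x BE first_coord_proj_E unfolding ergodic_mean_def
      by (intro E_diff E_scale E_sum cesaro_pow_E) auto
    ultimately show ?thesis by (simp add: wball_def first_coord_proj_def)
  qed
  then show ?thesis unfolding eventually_sequentially by blast
qed

lemma Lb_open_cont_ops: "Lb_open X (cont_ops X)"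
proof -
  have "bounded_in X {}" by (auto simp: bounded_in_def intro: exI[of _ 1])
  moreover have "zero_nbhd X (topspace X)"
    unfolding zero_nbhd_def by (simp add: E_0 topspace_X) (metis openin_topspace topspace_X)
  ultimately show ?thesis unfolding Lb_open_def by blast
qed

lemma uniformly_mean_ergodic_cesaro: "uniformly_mean_ergodic X cesaro"
  unfolding uniformly_mean_ergodic_def limitin_def
proof (intro conjI exI allI impI)
  show "cesaro \<in> cont_ops X" by (rule cesaro_cont_ops)
  show "first_coord_proj \<in> topspace (Lb_topology X)"
    using first_coord_proj_cont_ops Lb_open_cont_ops
    unfolding topspace_def openin_Lb_topology[OF lc_hausdorff_X] by blast
  fix W assume "openin (Lb_topology X) W \<and> first_coord_proj \<in> W"
  then obtain B V where BV: "bounded_in X B" "zero_nbhd X V"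
      "{R \<in> cont_ops X. \<forall>x\<in>B. R x - first_coord_proj x \<in> V} \<subseteq> W"
    unfolding openin_Lb_topology[OF lc_hausdorff_X] Lb_open_def by blast
  obtain w where w: "rapid w" "wball w \<subseteq> V" using zero_nbhd_X_contains_wball[OF BV(2)] by blast
  show "\<forall>\<^sub>F n in sequentially. ergodic_mean cesaro n \<in> W"
    using ergodic_mean_uniform_on_bounded[OF BV(1) w(1)]
    by eventually_elim (use w(2) BV(3) ergodic_mean_cont_ops in blast)
qed

section \<open>The kernel, the closure of the range and the decomposition\<close>

lemma kernel_eq_span: "{x \<in> E. x - cesaro x = 0} = cseq.span {\<lambda>_. 1}"
proof -
  have "{x \<in> E. x - cesaro x = 0} = range (\<lambda>c. cscale c (\<lambda>_. 1))"
    unfolding cesaro_fixed_iff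
  proof (intro equalityI subsetI)
    fix x assume "x \<in> {x \<in> E. \<forall>n. x n = x 0}"
    then have "x = cscale (x 0) (\<lambda>_. 1)" by (auto simp: cscale_def fun_eq_iff)
    then show "x \<in> range (\<lambda>c. cscale c (\<lambda>_. 1))" by blast
  next
    fix x assume "x \<in> range (\<lambda>c. cscale c (\<lambda>_. 1))"
    then obtain c where "x = (\<lambda>_. c)" by (auto simp: cscale_def)
    then show "x \<in> {x \<in> E. \<forall>n. x n = x 0}"
      using bounded_in_E[of x "cmod c"] by auto
  qed
  then show ?thesis by (simp add: cseq.span_singleton)
qed

lemma closedin_first_zero: "closedin X {x \<in> E. x 0 = 0}"
proof -
  have "closedin X {x \<in> topspace X. first_coord_proj x \<in> {0}}"
  proof (rule closedin_continuous_map_preimage)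
    show "continuous_map X X first_coord_proj"
      using first_coord_proj_cont_ops by (simp add: cont_ops_def)
    show "closedin X {0}"
      using lc_hausdorff_X E_0 by (intro closedin_Hausdorff_singleton) (auto simp: lc_hausdorff_def topspace_X)
  qed
  moreover have "{x \<in> topspace X. first_coord_proj x \<in> {0}} = {x \<in> E. x 0 = 0}"
    by (auto simp: topspace_X first_coord_proj_def fun_eq_iff)
  ultimately show ?thesis by simp
qed

lemma span_unit_seq_subset_range: "cseq.span {unit_seq n | n. 1 \<le> n} \<subseteq> (\<lambda>x. x - cesaro x) ` E"
proof (rule cseq.span_minimal)
  show "{unit_seq n | n. 1 \<le> n} \<subseteq> (\<lambda>x. x - cesaro x) ` E"
  proof clarify
    fix n :: nat assume n: "1 \<le> n"
    let ?y = "\<lambda>k. unit_seq n k + (if n \<le> k then 1 / of_nat n else 0)"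
    have "cmod (?y k) \<le> 2" for k
      using n by (auto simp: unit_seq_def norm_divide divide_le_eq
          intro: order_trans[OF norm_triangle_ineq])
    then have "?y \<in> E" by (rule bounded_in_E)
    then show "unit_seq n \<in> (\<lambda>x. x - cesaro x) ` E"
      by (rule rev_image_eqI) (rule unit_seq_eq_diff_cesaro[OF n, symmetric])
  qed
  show "cseq.subspace ((\<lambda>x. x - cesaro x) ` E)"
    unfolding cseq.subspace_def
  proof (intro conjI ballI allI)
    show "0 \<in> (\<lambda>x. x - cesaro x) ` E"
      using E_0 by (intro image_eqI[of _ _ 0]) (auto simp: cesaro_def fun_eq_iff)
    show "x + y \<in> (\<lambda>x. x - cesaro x) ` E"
      if "x \<in> (\<lambda>x. x - cesaro x) ` E" "y \<in> (\<lambda>x. x - cesaro x) ` E" for x y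
    proof -
      obtain a b where ab: "a \<in> E" "b \<in> E" "x = a - cesaro a" "y = b - cesaro b"
        using \<open>x \<in> _\<close> \<open>y \<in> _\<close> by blast
      then have "x + y = (a + b) - cesaro (a + b)" by (simp add: cesaro_add)
      then show ?thesis using E_add[OF ab(1,2)] by blast
    qed
    show "cscale c x \<in> (\<lambda>x. x - cesaro x) ` E" if x: "x \<in> (\<lambda>x. x - cesaro x) ` E" for c x
    proof -
      obtain a where a: "a \<in> E" "x = a - cesaro a" using x by blast
      then have "cscale c x = cscale c a - cesaro (cscale c a)"
        by (simp add: cesaro_scale cseq.scale_right_diff_distrib)
      then show ?thesis using E_scale[OF a(1)] by blast
    qed
  qed
qed

text \<open>Truncations converge: the tails of \<open>w n * cmod (x n)\<close> vanish for every rapid weight, and the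
  truncations avoid the first unit sequence because \<open>x 0 = 0\<close>.\<close>

lemma first_zero_subset_closure_span:
  "{x \<in> E. x 0 = 0} \<subseteq> X closure_of (cseq.span {unit_seq n | n. 1 \<le> n})"
proof
  fix x assume "x \<in> {x \<in> E. x 0 = 0}"
  then have x: "x \<in> E" "x 0 = 0" by auto
  show "x \<in> X closure_of (cseq.span {unit_seq n | n. 1 \<le> n})"
    unfolding in_closure_of
  proof (intro conjI allI impI)
    show "x \<in> topspace X" using x by (simp add: topspace_X)
    fix U assume U: "x \<in> U \<and> openin X U"
    then obtain w where w: "rapid w" "\<And>y. y \<in> E \<Longrightarrow> y - x \<in> wball w \<Longrightarrow> y \<in> U"
      unfolding openin_X_iff weighted_open_def by blast
    have "(\<lambda>n. w n * cmod (x n)) \<longlonglongrightarrow> 0"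
      using rapid_E_subset_c0[OF w(1)] x by (auto simp: c0_def)
    then have "\<forall>\<^sub>F n in sequentially. w n * cmod (x n) < 1"
      by (rule order_tendstoD(2)) simp
    then obtain N where N: "\<And>n. n \<ge> N \<Longrightarrow> w n * cmod (x n) < 1"
      by (auto simp: eventually_sequentially)
    define y where "y = (\<Sum>n\<in>{1..<N}. cscale (x n) (unit_seq n))"
    have yn: "y n = (if n < N then x n else 0)" for n
    proof -
      have "y n = (\<Sum>i\<in>{1..<N}. if n = i then x i else 0)"
        unfolding y_def cseq_sum_apply by (intro sum.cong) (auto simp: cscale_def unit_seq_def)
      also have "\<dots> = (if n \<in> {1..<N} then x n else 0)" by simp
      finally show ?thesis using x(2) by (cases "n = 0") auto
    qed
    have span: "y \<in> cseq.span {unit_seq n | n. 1 \<le> n}"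
      unfolding y_def by (intro cseq.span_sum cseq.span_scale cseq.span_base) auto
    have yE: "y \<in> E"
      unfolding y_def
      by (intro E_sum E_scale bounded_in_E[of _ 1]) (auto simp: unit_seq_def)
    have "w n * cmod ((y - x) n) \<le> 1" for n
      using N[of n] by (cases "n < N") (simp_all add: yn)
    then have "y - x \<in> wball w" using E_diff[OF yE x(1)] by (simp add: wball_def)
    then show "\<exists>y. y \<in> cseq.span {unit_seq n | n. 1 \<le> n} \<and> y \<in> U"
      using span w(2)[OF yE] by blast
  qed
qed

lemma closure_range_and_span:
  shows "X closure_of ((\<lambda>x. x - cesaro x) ` E) = {x \<in> E. x 0 = 0}"
    and "X closure_of (cseq.span {unit_seq n | n. 1 \<le> n}) = {x \<in> E. x 0 = 0}"
proof -
  have "(\<lambda>x. x - cesaro x) ` E \<subseteq> {x \<in> E. x 0 = 0}"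
    by (auto simp: E_diff cesaro_E) (simp add: cesaro_def)
  then have "X closure_of ((\<lambda>x. x - cesaro x) ` E) \<subseteq> {x \<in> E. x 0 = 0}"
    by (rule closure_of_minimal[OF _ closedin_first_zero])
  moreover have "X closure_of (cseq.span {unit_seq n | n. 1 \<le> n}) \<subseteq> X closure_of ((\<lambda>x. x - cesaro x) ` E)"
    by (rule closure_of_mono[OF span_unit_seq_subset_range])
  ultimately show "X closure_of ((\<lambda>x. x - cesaro x) ` E) = {x \<in> E. x 0 = 0}"
    and "X closure_of (cseq.span {unit_seq n | n. 1 \<le> n}) = {x \<in> E. x 0 = 0}"
    using first_zero_subset_closure_span by blast+
qed

text \<open>The inverse of the addition map is \<open>first_coord_proj\<close> paired with its complementary projection,
  and both were seen to be continuous on \<open>E\<close>.\<close>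

lemma direct_sum_constants_first_zero:
  "direct_sum X (cseq.span {\<lambda>_. 1}) {x \<in> E. x 0 = 0}"
  unfolding direct_sum_def
proof (intro conjI)
  let ?M = "cseq.span {\<lambda>_. 1}" and ?N = "{x \<in> E. x 0 = 0}"
  have M: "x \<in> ?M \<longleftrightarrow> x \<in> E \<and> (\<forall>n. x n = x 0)" for x
    unfolding kernel_eq_span[symmetric] cesaro_fixed_iff by blast
  show ME: "?M \<subseteq> topspace X" using M by (auto simp: topspace_X)
  show NE: "?N \<subseteq> topspace X" by (auto simp: topspace_X)
  show "cseq.subspace ?M" by simp
  show "cseq.subspace ?N"
    unfolding cseq.subspace_def by (auto simp: E_0 E_add E_scale) (simp add: cscale_def)
  have "homeomorphic_maps (prod_topology (subtopology X ?M) (subtopology X ?N)) X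
      (\<lambda>(x, y). x + y) (\<lambda>x. (first_coord_proj x, x - first_coord_proj x))"
    unfolding homeomorphic_maps_def
  proof (intro conjI ballI)
    show "continuous_map (prod_topology (subtopology X ?M) (subtopology X ?N)) X (\<lambda>(x, y). x + y)"
      unfolding subtopology_Times[symmetric]
      using lc_hausdorff_X by (intro continuous_map_from_subtopology) (simp add: lc_hausdorff_def)
    show "continuous_map X (prod_topology (subtopology X ?M) (subtopology X ?N))
        (\<lambda>x. (first_coord_proj x, x - first_coord_proj x))"
    proof (rule continuous_map_pairedI)
      show "continuous_map X (subtopology X ?M) first_coord_proj"
        using first_coord_proj_cont_ops
        by (auto simp: continuous_map_in_subtopology cont_ops_def M first_coord_proj_E)
          (simp add: first_coord_proj_def)
      show "continuous_map X (subtopology X ?N) (\<lambda>x. x - first_coord_proj x)"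
        using diff_first_coord_proj_cont_ops
        by (auto simp: continuous_map_in_subtopology cont_ops_def topspace_X E_diff first_coord_proj_E)
          (simp add: first_coord_proj_def)
    qed
    fix p assume "p \<in> topspace (prod_topology (subtopology X ?M) (subtopology X ?N))"
    then obtain x y where p: "p = (x, y)" "x \<in> ?M" "y \<in> ?N" by auto
    then have "first_coord_proj (x + y) = x"
      using M[of x] by (simp add: first_coord_proj_def fun_eq_iff) metis
    then show "(first_coord_proj (case p of (x, y) \<Rightarrow> x + y),
        (case p of (x, y) \<Rightarrow> x + y) - first_coord_proj (case p of (x, y) \<Rightarrow> x + y)) = p"
      by (simp add: p(1))
  qed simp
  then show "homeomorphic_map (prod_topology (subtopology X ?M) (subtopology X ?N)) X (\<lambda>(x, y). x + y)"
    unfolding homeomorphic_map_maps by blast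
qed

end

theorem proposition4p1:
  fixes \<alpha> s :: "nat \<Rightarrow> real"
  assumes "\<And>n. 0 < \<alpha> n" and "strict_mono \<alpha>" and "filterlim \<alpha> at_top sequentially"
    and "\<And>k. 1 < s k" and "strict_mono s" and "filterlim s at_top sequentially"
  shows "cesaro \<in> cont_ops (E_topology \<alpha> s) \<and>
     power_bounded (E_topology \<alpha> s) cesaro \<and>
     uniformly_mean_ergodic (E_topology \<alpha> s) cesaro \<and>
     direct_sum (E_topology \<alpha> s)
           {x \<in> E_space \<alpha> s. x - cesaro x = 0}
           (E_topology \<alpha> s closure_of ((\<lambda>x. x - cesaro x) ` E_space \<alpha> s)) \<and>
     {x \<in> E_space \<alpha> s. x - cesaro x = 0} = cseq.span {\<lambda>_. 1} \<and>
     E_topology \<alpha> s closure_of ((\<lambda>x. x - cesaro x) ` E_space \<alpha> s) =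
           {x \<in> E_space \<alpha> s. x 0 = 0} \<and>
     {x \<in> E_space \<alpha> s. x 0 = 0} =
           E_topology \<alpha> s closure_of (cseq.span {unit_seq n | n. 1 \<le> n})"
proof -
  interpret power_weights \<alpha> s
    using assms by unfold_locales
  show ?thesis
    unfolding closure_range_and_span kernel_eq_span
    using cesaro_cont_ops power_bounded_cesaro uniformly_mean_ergodic_cesaro
      direct_sum_constants_first_zero by simp
qed

end
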